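(* For each integer $k\ge 1$, there exists a positive integer $n_0=n_0(k)$ such that for all even $n\ge n_0$, $$R(C_n,B_n^{(k)})=(k+1)(n-1)+1.$$
   Context: All graphs are finite and simple. For graphs $G,H$, the Ramsey number $R(G,H)$ is the minimum $N$ such that every graph $\Gamma$ on $N$ vertices contains a copy of $G$ (as a not necessarily induced subgraph) or has complement containing a copy of $H$. $C_n$ denotes the cycle of length $n$. For positive integers $k,n$, the book graph $B_n^{(k)}$ is the graph consisting of $n$ copies of the complete graph $K_{k+1}$ all sharing a common $K_k$ (i.e. a $K_k$ together with $n$ further pairwise non-adjacent vertices, each adjacent to all vertices of the $K_k$). *)

theory Defs
  imports "HOL-Library.Ramsey"
begin

record 'a ugraph =
  verts :: "'a set"
  edges :: "'a set set"

definition simple_graph :: "'a ugraph \<Rightarrow> bool" where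
  "simple_graph G \<longleftrightarrow> finite (verts G) \<and> edges G \<subseteq> nsets (verts G) 2"

definition complement :: "'a ugraph \<Rightarrow> 'a ugraph" where
  "complement G = \<lparr>verts = verts G, edges = nsets (verts G) 2 - edges G\<rparr>"

definition contains_copy :: "'a ugraph \<Rightarrow> 'b ugraph \<Rightarrow> bool" where
  "contains_copy \<Gamma> G \<longleftrightarrow>
     (\<exists>f. inj_on f (verts G) \<and> f ` verts G \<subseteq> verts \<Gamma> \<and> (\<forall>e\<in>edges G. f ` e \<in> edges \<Gamma>))"

text \<open>
  The host graphs range over all finite simple graphs with vertices in \<^typ>\<open>nat\<close>; up to
  isomorphism these are all finite simple graphs. The number is a genuine minimum: see
  \<open>ramsey_number_exists\<close> below.
\<close>

definition ramsey_number :: "'a ugraph \<Rightarrow> 'b ugraph \<Rightarrow> nat" where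
  "ramsey_number G H =
     (LEAST N. \<forall>\<Gamma> :: nat ugraph. simple_graph \<Gamma> \<and> card (verts \<Gamma>) = N \<longrightarrow>
        contains_copy \<Gamma> G \<or> contains_copy (complement \<Gamma>) H)"

text \<open>This is the cycle \<open>C\<^sub>n\<close> only for \<open>n \<ge> 3\<close>.\<close>

definition cycle_graph :: "nat \<Rightarrow> nat ugraph" where
  "cycle_graph n = \<lparr>verts = {..<n}, edges = {{i, Suc i mod n} | i. i < n}\<rparr>"

text \<open>
  \<open>book_graph k n\<close> is \<open>B\<^sub>n\<^bsup>(k)\<^esup>\<close>: the vertices \<open>0, \<dots>, k - 1\<close> form the common \<open>K\<^sub>k\<close>, and
  \<open>k, \<dots>, k + n - 1\<close> are the \<open>n\<close> further vertices.
\<close>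

definition book_graph :: "nat \<Rightarrow> nat \<Rightarrow> nat ugraph" where
  "book_graph k n = \<lparr>verts = {..<k + n}, edges = {{i, j} | i j. i < k \<and> j < k + n \<and> i \<noteq> j}\<rparr>"

lemma simple_graph_cycle_graph: "n \<ge> 3 \<Longrightarrow> simple_graph (cycle_graph n)"
proof -
  assume n: "n \<ge> 3"
  have "{i, Suc i mod n} \<in> nsets {..<n} 2" if "i < n" for i
  proof -
    have "i \<noteq> Suc i mod n"
      using n that by (cases "Suc i = n") auto
    then show ?thesis
      using n that by (simp add: nsets_def)
  qed
  then show ?thesis
    by (auto simp: simple_graph_def cycle_graph_def)
qed

lemma simple_graph_book_graph: "simple_graph (book_graph k n)"
  by (auto simp: simple_graph_def book_graph_def nsets_def)

lemma contains_copy_if_clique: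
  assumes G: "simple_graph G" and R: "R \<subseteq> verts \<Gamma>" "finite R" "card R = card (verts G)"
    and E: "nsets R 2 \<subseteq> edges \<Gamma>"
  shows "contains_copy \<Gamma> G"
proof -
  have "finite (verts G)"
    using G by (simp add: simple_graph_def)
  then obtain f where f: "bij_betw f (verts G) R"
    using R finite_same_card_bij by metis
  have "f ` e \<in> edges \<Gamma>" if "e \<in> edges G" for e
  proof -
    have e: "e \<subseteq> verts G" "finite e" "card e = 2"
      using that G by (auto simp: simple_graph_def nsets_def)
    then have "card (f ` e) = 2"
      using f by (metis bij_betw_def card_image inj_on_subset)
    moreover have "f ` e \<subseteq> R"
      using e f by (auto simp: bij_betw_def)
    ultimately show ?thesis
      using E e by (auto simp: nsets_def)
  qed
  then show ?thesis
    unfolding contains_copy_def using f R by (auto simp: bij_betw_def intro!: exI[of _ f])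
qed

lemma ramsey_number_exists:
  assumes "simple_graph G" "simple_graph H"
  shows "\<exists>N. \<forall>\<Gamma> :: 'c ugraph. simple_graph \<Gamma> \<and> card (verts \<Gamma>) = N \<longrightarrow>
           contains_copy \<Gamma> G \<or> contains_copy (complement \<Gamma>) H"
proof -
  obtain N :: nat where N: "N \<ge> 1" "\<And>(V :: 'c set) E. finite V \<Longrightarrow> card V \<ge> N \<Longrightarrow>
      \<exists>R \<subseteq> V. card R = card (verts G) \<and> clique R E \<or> card R = card (verts H) \<and> indep R E"
    using ramsey2[of "card (verts G)" "card (verts H)"] by meson
  have "contains_copy \<Gamma> G \<or> contains_copy (complement \<Gamma>) H"
    if \<Gamma>: "simple_graph \<Gamma>" "card (verts \<Gamma>) = N" for \<Gamma> :: "'c ugraph"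
  proof -
    have fin: "finite (verts \<Gamma>)"
      using \<Gamma> by (simp add: simple_graph_def)
    obtain R where R: "R \<subseteq> verts \<Gamma>"
      "card R = card (verts G) \<and> clique R (edges \<Gamma>) \<or> card R = card (verts H) \<and> indep R (edges \<Gamma>)"
      using N(2)[of "verts \<Gamma>" "edges \<Gamma>"] fin \<Gamma> by auto
    have finR: "finite R"
      using R fin finite_subset by blast
    from R(2) show ?thesis
    proof
      assume *: "card R = card (verts G) \<and> clique R (edges \<Gamma>)"
      then have "nsets R 2 \<subseteq> edges \<Gamma>"
        by (auto simp: clique_def nsets_def card_2_iff)
      then show ?thesis
        using contains_copy_if_clique[OF assms(1) R(1) finR] * by blast
    next
      assume *: "card R = card (verts H) \<and> indep R (edges \<Gamma>)"
      then have "nsets R 2 \<subseteq> edges (complement \<Gamma>)"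
        using R(1) by (auto simp: complement_def indep_def nsets_def card_2_iff)
      moreover have "R \<subseteq> verts (complement \<Gamma>)"
        using R(1) by (simp add: complement_def)
      ultimately show ?thesis
        using contains_copy_if_clique[OF assms(2) _ finR] * by blast
    qed
  qed
  then show ?thesis by blast
qed

end

theory Submission
  imports Defs Complex_Main
begin

text \<open>
  For the upper bound, induct on \<open>k\<close>: a vertex \<open>v\<close> of degree at most \<open>n - 2\<close> can be added to the
  spine of a book found among its non-neighbours. So the minimum degree may be assumed to be at least
  \<open>n - 1\<close> on at most \<open>(k + 1) n\<close> vertices, and for large even \<open>n\<close> this alone forces a \<open>C\<^sub>n\<close>.

  Iteratively pass to a smaller pair \<open>(X, Y)\<close> of vertex sets, equal or disjoint, such that every
  vertex has almost \<open>n\<close> neighbours on the other side, until no such pair is substantially smaller.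
  If \<open>X \<union> Y\<close> has fewer than \<open>1.1 n\<close> vertices, it is close to a clique: either it has \<open>n\<close> vertices and
  one inserts vertices into a cycle one by one, or the missing vertices are gained by short excursions
  outside \<open>X \<union> Y\<close>, which exist by the degree condition. If \<open>X \<union> Y\<close> is larger, then minimality makes
  \<open>(X, Y)\<close> robustly connected, so any two vertices of \<open>Y\<close> are joined by a path of one fixed even
  length. A bounded set of such paths reaches almost all vertices of \<open>X\<close>, and closes a suitable
  segment of a long path that avoids it to a cycle of length exactly \<open>n\<close>.
\<close>

section \<open>Near-complete pieces\<close>

text \<open>A relation takes the place of a \<open>ugraph\<close> so that the path lemmas can be
  reused for a subrelation, namely the edges that run between the two sides of a pair.\<close>

locale graph_rel =
  fixes E :: "'a \<Rightarrow> 'a \<Rightarrow> bool"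
  assumes sym: "E x y \<Longrightarrow> E y x" and irrefl: "\<not> E x x"
begin

definition nb :: "'a \<Rightarrow> 'a set \<Rightarrow> 'a set" where
  "nb v S = {u \<in> S. E v u}"

definition is_path :: "'a list \<Rightarrow> bool" where
  "is_path xs \<longleftrightarrow> distinct xs \<and> successively E xs"

text \<open>A cycle is a path closed by the edge from its last vertex to its first. For
  \<open>n = 2\<close> a single edge qualifies, so this is the usual notion from
  \<open>n = 3\<close> on.\<close>

definition has_cycle :: "'a set \<Rightarrow> nat \<Rightarrow> bool" where
  "has_cycle V n \<longleftrightarrow>
     (\<exists>xs. length xs = n \<and> set xs \<subseteq> V \<and> is_path xs \<and> xs \<noteq> [] \<and> E (last xs) (hd xs))"

lemma nb_subset: "nb v S \<subseteq> S"
  by (auto simp: nb_def)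

lemma finite_nb [simp]: "finite S \<Longrightarrow> finite (nb v S)"
  using finite_subset[OF nb_subset] .

lemma card_nb_mono: "S \<subseteq> T \<Longrightarrow> finite T \<Longrightarrow> card (nb v S) \<le> card (nb v T)"
  by (rule card_mono) (auto simp: nb_def)

lemma sym_iff: "E x y \<longleftrightarrow> E y x"
  using sym by blast

lemma sum_card_nb:
  assumes "finite P" "finite Q"
  shows "(\<Sum>p\<in>P. card (nb p Q)) = (\<Sum>q\<in>Q. card (nb q P))"
proof -
  have "(\<Sum>p\<in>P. card (nb p Q)) = (\<Sum>p\<in>P. \<Sum>q\<in>Q. if E p q then 1 else 0)"
    using assms by (intro sum.cong refl) (simp add: nb_def flip: sum.inter_filter)
  also have "\<dots> = (\<Sum>q\<in>Q. \<Sum>p\<in>P. if E q p then 1 else 0)"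
    by (subst sum.swap) (simp add: sym_iff)
  also have "\<dots> = (\<Sum>q\<in>Q. card (nb q P))"
    using assms by (intro sum.cong refl) (simp add: nb_def flip: sum.inter_filter)
  finally show ?thesis .
qed

text \<open>Count the edges between \<open>P'\<close> and \<open>Q\<close> from both sides. It
  serves with \<open>a\<close> much smaller than \<open>b\<close>: a sparse pair has few vertices of
  large degree.\<close>

lemma card_many_nb_le:
  assumes fin: "finite P" "finite Q" and "P' \<subseteq> P"
    and Q: "\<And>q. q \<in> Q \<Longrightarrow> real (card (nb q P)) \<le> a"
    and P': "\<And>p. p \<in> P' \<Longrightarrow> b \<le> real (card (nb p Q))"
  shows "real (card P') * b \<le> real (card Q) * a"
proof -
  have fP': "finite P'"
    using assms finite_subset by blast
  have "real (card P') * b \<le> real (\<Sum>p\<in>P'. card (nb p Q))"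
    using sum_mono[of P' "\<lambda>_. b" "\<lambda>p. real (card (nb p Q))"] P' by simp
  also have "\<dots> = real (\<Sum>q\<in>Q. card (nb q P'))"
    using sum_card_nb[OF fP' fin(2)] by simp
  also have "\<dots> \<le> (\<Sum>q\<in>Q. a)"
    unfolding of_nat_sum
  proof (rule sum_mono)
    fix q assume "q \<in> Q"
    then show "real (card (nb q P')) \<le> a"
      using Q[of q] card_nb_mono[OF \<open>P' \<subseteq> P\<close> fin(1), of q] by linarith
  qed
  finally show ?thesis by simp
qed

text \<open>Degrees are subadditive over a cover. The exceptional set \<open>B\<close> is charged by
  its full size; empty sets fill the slots when there are fewer parts.\<close>

lemma card_nb_cover:
  assumes "Y \<subseteq> T \<union> P \<union> Q \<union> B" "finite T" "finite P" "finite Q" "finite B"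
  shows "card (nb v Y) \<le> card (nb v T) + card (nb v P) + card (nb v Q) + card B"
proof -
  have "card (nb v Y) \<le> card (nb v T \<union> nb v P \<union> nb v Q \<union> B)"
    using assms by (intro card_mono) (auto simp: nb_def)
  also have "\<dots> \<le> card (nb v T) + card (nb v P) + card (nb v Q) + card B"
    by (meson add_le_mono card_Un_le le_refl order_trans)
  finally show ?thesis .
qed

lemma is_path_Cons: "is_path (x # xs) \<longleftrightarrow> x \<notin> set xs \<and> is_path xs \<and> (xs = [] \<or> E x (hd xs))"
  by (cases xs) (auto simp: is_path_def)

lemma is_path_append:
  "is_path (xs @ ys) \<longleftrightarrow> is_path xs \<and> is_path ys \<and> set xs \<inter> set ys = {} \<and>
     (xs = [] \<or> ys = [] \<or> E (last xs) (hd ys))"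
  by (auto simp: is_path_def successively_append_iff)

lemma is_path_rev: "is_path (rev xs) \<longleftrightarrow> is_path xs"
proof -
  have *: "(\<lambda>x y. E y x) = E"
    using sym_iff by blast
  show ?thesis
    by (simp only: is_path_def distinct_rev successively_rev *)
qed

end

section \<open>Panconnectivity of dense sets\<close>

text \<open>Cut the list into consecutive pairs; each of them contains an element that violates
  \<open>P\<close>.\<close>

lemma filter_not_ge_half:
  assumes "\<nexists>ys u w zs. xs = ys @ u # w # zs \<and> P u \<and> P w"
  shows "length xs div 2 \<le> length (filter (\<lambda>x. \<not> P x) xs)"
  using assms
proof (induction xs rule: induct_list012)
  case (3 u w zs)
  have "\<nexists>ys u w zs'. zs = ys @ u # w # zs' \<and> P u \<and> P w"
    using "3.prems" by (metis append_Cons)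
  moreover have "\<not> (P u \<and> P w)"
    using "3.prems" by (metis append_Nil)
  ultimately show ?case
    using "3.IH"(1) by auto
qed auto

context graph_rel
begin

lemma common_nb:
  assumes "finite S" "u \<in> S" "w \<in> S" and x: "\<And>v. v \<in> S \<Longrightarrow> card {z \<in> S. \<not> E v z} \<le> x"
    and F: "finite F" "card F + 2 * x < card S"
  obtains z where "z \<in> S" "z \<notin> F" "E u z" "E w z"
proof -
  have "card ({z \<in> S. \<not> E u z} \<union> {z \<in> S. \<not> E w z} \<union> F) \<le> x + x + card F"
    using x[OF \<open>u \<in> S\<close>] x[OF \<open>w \<in> S\<close>]
    by (meson add_le_mono card_Un_le le_refl order_trans)
  also have "\<dots> < card S"
    using F by simp
  finally have "\<not> S \<subseteq> {z \<in> S. \<not> E u z} \<union> {z \<in> S. \<not> E w z} \<union> F"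
    using \<open>finite S\<close> F(1) card_mono[of "{z \<in> S. \<not> E u z} \<union> {z \<in> S. \<not> E w z} \<union> F" S] by auto
  then show thesis
    using that by blast
qed

text \<open>A path from \<open>a\<close> to \<open>b\<close> is lengthened one vertex at a time, by
  inserting a new vertex between two consecutive ones. The bound \<open>x\<close> counts
  \<open>v\<close> among its own non-neighbours.\<close>

lemma panconnected:
  assumes S: "finite S" and x: "\<And>v. v \<in> S \<Longrightarrow> card {u \<in> S. \<not> E v u} \<le> x" and "4 * x \<le> card S"
    and ab: "a \<in> S" "b \<in> S" "a \<noteq> b" and l: "3 \<le> l" "l \<le> card S"
  shows "\<exists>xs. length xs = l \<and> set xs \<subseteq> S \<and> is_path xs \<and> hd xs = a \<and> last xs = b"
  using l
proof (induction l rule: dec_induct)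
  case base
  have "{a} \<subseteq> {u \<in> S. \<not> E a u}"
    using ab irrefl by auto
  then have "x \<ge> 1"
    using x[OF ab(1)] card_mono[of "{u \<in> S. \<not> E a u}" "{a}"] S by simp
  then have "card {} + 2 * x < card S"
    using \<open>4 * x \<le> card S\<close> by simp
  then obtain z where "z \<in> S" "E a z" "E b z"
    using common_nb[OF S ab(1,2) x] by blast
  then show ?case
    using ab irrefl sym[OF \<open>E b z\<close>] by (intro exI[of _ "[a, z, b]"]) (auto simp: is_path_def)
next
  case (step l)
  then obtain xs where xs: "length xs = l" "set xs \<subseteq> S" "is_path xs" "hd xs = a" "last xs = b"
    by auto
  have dist: "distinct xs"
    using xs by (simp add: is_path_def)
  have "\<exists>v ys u w zs. v \<in> S \<and> v \<notin> set xs \<and> xs = ys @ u # w # zs \<and> E v u \<and> E v w"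
  proof (cases "l + 2 * x < card S")
    case True
    \<comment> \<open>There is room for a common neighbour of the first two path vertices outside
      the path.\<close>
    obtain u w zs where uw: "xs = u # w # zs"
      using xs(1) step(1) by (metis Suc_le_length_iff numeral_3_eq_3)
    have "card (set xs) + 2 * x < card S"
      using True dist xs(1) by (simp add: distinct_card)
    then obtain z where "z \<in> S" "z \<notin> set xs" "E u z" "E w z"
      using common_nb[OF S, of u w x "set xs"] x xs(2) uw by auto
    moreover have "xs = [] @ u # w # zs"
      using uw by simp
    ultimately show ?thesis
      using sym by blast
  next
    case False
    \<comment> \<open>Now \<open>l \<ge> card S - 2 * x \<ge> 2 * x\<close>. A vertex
      \<open>v\<close> off the path that fits nowhere would miss at least \<open>x\<close> path
      vertices and, in addition, itself.\<close>
    have "card (set xs) < card S"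
      using dist xs(1) step.prems by (simp add: distinct_card)
    then obtain v where v: "v \<in> S" "v \<notin> set xs"
      using xs(2) by (metis less_irrefl subsetI subset_antisym)
    show ?thesis
    proof (rule ccontr)
      assume "\<not> ?thesis"
      then have "\<nexists>ys u w zs. xs = ys @ u # w # zs \<and> E v u \<and> E v w"
        using v by blast
      then have "length xs div 2 \<le> length (filter (\<lambda>u. \<not> E v u) xs)"
        by (rule filter_not_ge_half)
      also have "\<dots> = card {u \<in> set xs. \<not> E v u}"
        using dist by (metis distinct_card distinct_filter set_filter)
      finally have 1: "x \<le> card {u \<in> set xs. \<not> E v u}"
        using False \<open>4 * x \<le> card S\<close> xs(1) by linarith
      have "insert v {u \<in> set xs. \<not> E v u} \<subseteq> {u \<in> S. \<not> E v u}"
        using v xs(2) irrefl by auto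
      then have "card (insert v {u \<in> set xs. \<not> E v u}) \<le> card {u \<in> S. \<not> E v u}"
        using S by (intro card_mono) auto
      then have "card (insert v {u \<in> set xs. \<not> E v u}) \<le> x"
        using x[OF v(1)] by linarith
      then show False
        using 1 v by simp
    qed
  qed
  then obtain v ys u w zs where v: "v \<in> S" "v \<notin> set xs" "E v u" "E v w" and eq: "xs = ys @ u # w # zs"
    by blast
  let ?xs = "ys @ u # v # w # zs"
  have "is_path ?xs"
    using xs(3) v sym[OF v(3)] unfolding eq by (auto simp: is_path_def successively_append_iff successively_Cons)
  moreover have "hd ?xs = a" "last ?xs = b" "length ?xs = Suc l" "set ?xs \<subseteq> S"
    using xs v unfolding eq by (auto simp: hd_append)
  ultimately show ?case by blast
qed

text \<open>A path on \<open>n\<close> vertices whose ends are chosen adjacent closes to a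
  cycle.\<close>

lemma cycle_if_dense:
  assumes "finite A" "A \<subseteq> V" and x: "\<And>v. v \<in> A \<Longrightarrow> card {u \<in> A. \<not> E v u} \<le> x"
    and "4 * x \<le> card A" "3 \<le> n" "n \<le> card A"
  shows "has_cycle V n"
proof -
  obtain a where a: "a \<in> A"
    using assms by (metis card.empty ex_in_conv le_zero_eq not_numeral_le_zero order_trans)
  have "x < card A"
    using assms by linarith
  then have "\<not> A \<subseteq> {u \<in> A. \<not> E a u}"
    using x[OF a] \<open>finite A\<close> card_mono[of "{u \<in> A. \<not> E a u}" A] by auto
  then obtain b where b: "b \<in> A" "E a b"
    by blast
  then have "a \<noteq> b"
    using irrefl by blast
  then obtain xs where "length xs = n" "set xs \<subseteq> A" "is_path xs" "hd xs = a" "last xs = b"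
    using panconnected[OF \<open>finite A\<close> x \<open>4 * x \<le> card A\<close> a b(1)] assms by blast
  then show ?thesis
    unfolding has_cycle_def using sym[OF b(2)] \<open>A \<subseteq> V\<close> \<open>3 \<le> n\<close> by (intro exI[of _ xs]) auto
qed

section \<open>Excursions out of a near-clique\<close>

text \<open>If an outside vertex has two neighbours in \<open>A - Q\<close>, three vertices suffice.
  Otherwise distinct \<open>a\<close> have distinct outside neighbours \<open>f a\<close>, whose
  neighbourhoods lie mostly outside \<open>A\<close>; two of these must meet, which gives five
  vertices.\<close>

lemma excursion:
  assumes fin: "finite V" and "A \<subseteq> V" and V: "card V \<le> K * n"
    and deg: "\<And>v. v \<in> V \<Longrightarrow> n - 1 \<le> card (nb v V)"
    and Q: "finite Q" "2 * card Q + 4 \<le> n"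
    and A: "2 * K + 1 \<le> card (A - Q)"
    and out: "\<And>a. a \<in> A - Q \<Longrightarrow> nb a (V - A - Q) \<noteq> {}"
  shows "\<exists>ys. is_path ys \<and> ys \<noteq> [] \<and> set ys \<subseteq> V - Q \<and> hd ys \<in> A \<and> last ys \<in> A \<and>
    \<not> set ys \<subseteq> A \<and> length ys \<le> 5"
proof (cases "\<exists>h\<in>V - A - Q. \<exists>a\<in>A - Q. \<exists>a'\<in>A - Q. a \<noteq> a' \<and> E a h \<and> E h a'")
  case True
  then obtain h a a' where "h \<in> V - A - Q" "a \<in> A - Q" "a' \<in> A - Q" "a \<noteq> a'" "E a h" "E h a'"
    by blast
  then show ?thesis
    using \<open>A \<subseteq> V\<close> irrefl by (intro exI[of _ "[a, h, a']"]) (auto simp: is_path_def)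
next
  case False
  define H where "H = V - A - Q"
  have "\<forall>a\<in>A - Q. \<exists>h. h \<in> H \<and> E a h"
    using out unfolding H_def by (fastforce simp: nb_def)
  then obtain f where f: "\<And>a. a \<in> A - Q \<Longrightarrow> f a \<in> H" "\<And>a. a \<in> A - Q \<Longrightarrow> E a (f a)"
    by metis
  have uniq: "a = a'" if "h \<in> H" "a \<in> A - Q" "a' \<in> A - Q" "E a h" "E a' h" for h a a'
    using False that sym unfolding H_def by blast
  then have f_neq: "f a \<noteq> f a'" if "a \<in> A - Q" "a' \<in> A - Q" "a \<noteq> a'" for a a'
    using f that by metis
  have finA: "finite A" "finite H"
    using fin \<open>A \<subseteq> V\<close> finite_subset unfolding H_def by auto
  \<comment> \<open>Apart from \<open>a\<close> and \<open>Q\<close> all neighbours of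
    \<open>f a\<close> lie in \<open>H\<close>, and
    \<open>n - 2 - card Q \<ge> n / 2\<close>.\<close>
  have degH: "n \<le> 2 * card (nb (f a) H)" if a: "a \<in> A - Q" for a
  proof -
    have "nb (f a) (A - Q) \<subseteq> {a}"
      using uniq[OF f(1)[OF a] a] f(2)[OF a] sym by (fastforce simp: nb_def)
    then have "card (nb (f a) (A - Q)) \<le> 1"
      using card_mono[of "{a}"] by fastforce
    moreover have "n - 1 \<le> card (nb (f a) V)"
      using f(1)[OF a] deg unfolding H_def by blast
    moreover have "card (nb (f a) V) \<le> card (nb (f a) H) + card (nb (f a) (A - Q)) + card (nb (f a) {}) + card Q"
      using finA Q by (intro card_nb_cover) (auto simp: H_def)
    ultimately show ?thesis
      using Q by (simp add: nb_def)
  qed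
  \<comment> \<open>Pairwise disjoint neighbourhoods of size \<open>n / 2\<close> for
    \<open>2 * K + 1\<close> vertices would not fit into \<open>K * n\<close> vertices.\<close>
  obtain B where B: "B \<subseteq> A - Q" "card B = 2 * K + 1" "finite B"
    using A by (rule obtain_subset_with_card_n)
  have "\<exists>a\<in>B. \<exists>a'\<in>B. a \<noteq> a' \<and> nb (f a) H \<inter> nb (f a') H \<noteq> {}"
  proof (rule ccontr)
    assume "\<not> ?thesis"
    then have "card (\<Union>a\<in>B. nb (f a) H) = (\<Sum>a\<in>B. card (nb (f a) H))"
      using B finA by (intro card_UN_disjoint) auto
    moreover have "(\<Sum>a\<in>B. n) \<le> (\<Sum>a\<in>B. 2 * card (nb (f a) H))"
      using degH B by (intro sum_mono) blast
    moreover have "card (\<Union>a\<in>B. nb (f a) H) \<le> card V"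
      using fin by (intro card_mono) (auto simp: nb_def H_def)
    ultimately have "(2 * K + 1) * n \<le> 2 * (K * n)"
      using V B by (simp add: sum_distrib_left[symmetric])
    then show False
      using Q by simp
  qed
  then obtain a a' u where a: "a \<in> A - Q" "a' \<in> A - Q" "a \<noteq> a'" and u: "u \<in> H" "E (f a) u" "E (f a') u"
    using B by (auto simp: nb_def)
  have "is_path [a, f a, u, f a', a']"
    using a u f(1)[OF a(1)] f(2)[OF a(1)] f(1)[OF a(2)] sym[OF f(2)[OF a(2)]] f_neq[OF a] sym[OF u(3)] irrefl
    by (auto simp: is_path_def H_def)
  then show ?thesis
    using a f(1)[OF a(1)] f(1)[OF a(2)] u \<open>A \<subseteq> V\<close>
    by (intro exI[of _ "[a, f a, u, f a', a']"]) (auto simp: H_def)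
qed

text \<open>Excursions are glued together through single vertices of \<open>A\<close>. A round gains
  at least one vertex outside \<open>A\<close> and costs at most \<open>5 + 1\<close> vertices, so
  the path stays short and most of \<open>A\<close> remains free.\<close>

lemma path_with_excursions:
  assumes fin: "finite V" and "A \<subseteq> V" and V: "card V \<le> K * n"
    and deg: "\<And>v. v \<in> V \<Longrightarrow> n - 1 \<le> card (nb v V)"
    and x: "\<And>v. v \<in> A \<Longrightarrow> card {u \<in> A. \<not> E v u} \<le> x"
    and "card A < n" "20 * (n - card A) \<le> n" "20 * x \<le> n" "100 * K + 100 \<le> n"
    and t: "t \<le> n - card A"
  shows "\<exists>ys. is_path ys \<and> ys \<noteq> [] \<and> set ys \<subseteq> V \<and> hd ys \<in> A \<and> last ys \<in> A \<and>
    t \<le> card (set ys - A) \<and> length ys \<le> 6 * t + 1"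
  using t
proof (induction t)
  case 0
  have "A \<noteq> {}"
    using assms by auto
  then obtain a where "a \<in> A"
    by blast
  then show ?case
    using \<open>A \<subseteq> V\<close> by (intro exI[of _ "[a]"]) (auto simp: is_path_def)
next
  case (Suc t)
  then obtain ys where ys: "is_path ys" "ys \<noteq> []" "set ys \<subseteq> V" "hd ys \<in> A" "last ys \<in> A"
    "t \<le> card (set ys - A)" "length ys \<le> 6 * t + 1"
    by (metis Suc_leD)
  show ?case
  proof (cases "Suc t \<le> card (set ys - A)")
    case True
    then show ?thesis
      using ys by (intro exI[of _ ys]) auto
  next
    case False
    let ?Q = "set ys"
    have finA: "finite A"
      using fin \<open>A \<subseteq> V\<close> finite_subset by blast
    have cardQ: "card ?Q \<le> 6 * t + 1"
      using ys(7) card_length le_trans by blast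
    \<comment> \<open>Of at least \<open>n - 1\<close> neighbours of \<open>a\<close>, at most
      \<open>card A - 1\<close> lie in \<open>A\<close>, and at most \<open>t < n - card A\<close>
      outside vertices are used up.\<close>
    have out: "nb a (V - A - ?Q) \<noteq> {}" if a: "a \<in> A - ?Q" for a
    proof -
      have "nb a A \<subseteq> A - {a}"
        using irrefl by (auto simp: nb_def)
      then have "card (nb a A) \<le> card A - 1"
        using card_mono[of "A - {a}" "nb a A"] finA a by simp
      moreover have "card A > 0"
        using a finA card_gt_0_iff by blast
      moreover have "n - 1 \<le> card (nb a V)"
        using a deg \<open>A \<subseteq> V\<close> by blast
      moreover have "card (nb a V) \<le> card (nb a (V - A - ?Q)) + card (nb a A) + card (nb a {}) + card (?Q - A)"
        using fin finA by (intro card_nb_cover) auto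
      ultimately have "card (nb a (V - A - ?Q)) > 0"
        using False Suc.prems \<open>card A < n\<close> by (simp add: nb_def)
      then show ?thesis
        by auto
    qed
    have "card A - card ?Q \<le> card (A - ?Q)"
      by (simp add: diff_card_le_card_Diff)
    moreover have *: "19 * n \<le> 20 * card A"
      using assms(7) by (simp add: diff_mult_distrib2)
    moreover have "20 * t + 20 \<le> n"
      using mult_le_mono2[OF Suc.prems, of 20] assms(7) by simp
    ultimately have big: "2 * K + 1 \<le> card (A - ?Q)" "2 * card ?Q + 4 \<le> n"
      using assms(8,9) cardQ by linarith+
    obtain zs where zs: "is_path zs" "zs \<noteq> []" "set zs \<subseteq> V - ?Q" "hd zs \<in> A" "last zs \<in> A"
      "\<not> set zs \<subseteq> A" "length zs \<le> 5"
      using excursion[OF fin \<open>A \<subseteq> V\<close> V deg _ big(2,1) out] by (auto; metis)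
    have "card (?Q \<union> set zs) \<le> 6 * t + 6"
      using card_Un_le[of ?Q "set zs"] cardQ card_length[of zs] zs(7) by linarith
    then have "card (?Q \<union> set zs) + 2 * x < card A"
      using assms(8,9) * \<open>20 * t + 20 \<le> n\<close> by linarith
    then obtain c where c: "c \<in> A" "c \<notin> ?Q \<union> set zs" "E (last ys) c" "E (hd zs) c"
      using common_nb[OF finA ys(5) zs(4) x, of "?Q \<union> set zs"] by blast
    have "is_path (ys @ c # zs)"
      using ys zs c sym[OF c(4)] by (auto simp: is_path_append is_path_Cons)
    moreover have "Suc t \<le> card (set (ys @ c # zs) - A)"
    proof -
      obtain w where "w \<in> set zs" "w \<notin> A"
        using zs(6) by blast
      then have "insert w (?Q - A) \<subseteq> set (ys @ c # zs) - A" "w \<notin> ?Q"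
        using zs(3) by auto
      then have "card (insert w (?Q - A)) \<le> card (set (ys @ c # zs) - A)"
        by (intro card_mono) auto
      then show ?thesis
        using ys(6) \<open>w \<notin> ?Q\<close> by simp
    qed
    ultimately show ?thesis
      using ys zs c(1) \<open>A \<subseteq> V\<close> by (intro exI[of _ "ys @ c # zs"]) auto
  qed
qed

lemma cycle_if_near_clique:
  assumes fin: "finite V" and "A \<subseteq> V" and V: "card V \<le> K * n"
    and deg: "\<And>v. v \<in> V \<Longrightarrow> n - 1 \<le> card (nb v V)"
    and x: "\<And>v. v \<in> A \<Longrightarrow> card {u \<in> A. \<not> E v u} \<le> x"
    and "card A < n" "20 * (n - card A) \<le> n" "20 * x \<le> n" "100 * K + 100 \<le> n"
  shows "has_cycle V n"
proof -
  let ?q = "n - card A"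
  obtain ys where ys: "is_path ys" "ys \<noteq> []" "set ys \<subseteq> V" "hd ys \<in> A" "last ys \<in> A"
    "?q \<le> card (set ys - A)" "length ys \<le> 6 * ?q + 1"
    using path_with_excursions[OF assms, of ?q] by blast
  have finA: "finite A"
    using fin \<open>A \<subseteq> V\<close> finite_subset by blast
  have neq: "last ys \<noteq> hd ys"
  proof
    assume eq: "last ys = hd ys"
    have "length ys \<le> 1"
      using ys(1,2) eq by (cases ys) (auto simp: is_path_def split: if_splits)
    then have "set ys \<subseteq> A"
      using ys(2,4) by (cases ys) auto
    then have "card (set ys - A) = 0"
      by (metis Diff_eq_empty_iff card.empty)
    then show False
      using ys(6) \<open>card A < n\<close> by linarith
  qed
  define S where "S = (A - set ys) \<union> {hd ys, last ys}"
  have S: "finite S" "S \<subseteq> A" "last ys \<in> S" "hd ys \<in> S"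
    using finA ys by (auto simp: S_def)
  have len: "card (set ys) = length ys"
    using ys(1) by (simp add: is_path_def distinct_card)
  have cS: "card S = card (A - set ys) + 2"
    unfolding S_def using finA ys(2) neq
    by (subst card_Un_disjoint) auto
  have "card (A \<union> set ys) = card A + card (set ys - A)"
    using finA by (metis Diff_disjoint List.finite_set Un_Diff_cancel card_Un_disjoint finite_Diff)
  moreover have "card (A \<union> set ys) = card (A - set ys) + card (set ys)"
    using finA by (metis List.finite_set card_Un_disjoint Un_Diff_cancel2 Diff_disjoint finite_Diff inf_commute)
  ultimately have "n \<le> card (A - set ys) + length ys"
    using ys(6) \<open>card A < n\<close> len by linarith
  moreover have q: "19 * n \<le> 20 * card A" "20 * ?q \<le> n"
    using assms(7) by (simp_all add: diff_mult_distrib2)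
  moreover have len3: "length ys + 3 \<le> n"
    using ys(7) q(2) assms(9) by linarith
  \<comment> \<open>The two paths share their ends, hence the \<open>+ 2\<close>.\<close>
  ultimately have l: "3 \<le> n + 2 - length ys" "n + 2 - length ys \<le> card S"
    using cS by linarith+
  have "card A \<le> card (A - set ys) + length ys"
    using len diff_card_le_card_Diff[of "set ys" A] by simp
  then have "4 * x \<le> card S"
    using cS ys(7) assms(8,9) q by linarith
  have xS: "card {u \<in> S. \<not> E v u} \<le> x" if "v \<in> S" for v
  proof -
    have "card {u \<in> S. \<not> E v u} \<le> card {u \<in> A. \<not> E v u}"
      using finA S by (intro card_mono) auto
    then show ?thesis
      using x[of v] S that by fastforce
  qed
  obtain zs where zs: "length zs = n + 2 - length ys" "set zs \<subseteq> S" "is_path zs" "hd zs = last ys" "last zs = hd ys"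
    using panconnected[OF S(1) xS \<open>4 * x \<le> card S\<close> S(3,4) neq l] by blast
  define ws where "ws = butlast (tl zs)"
  have eq: "zs = last ys # ws @ [hd ys]"
  proof -
    have "zs \<noteq> []" "tl zs \<noteq> []"
      using zs(1) l by (cases zs; cases "tl zs"; auto)+
    then show ?thesis
      using zs(4,5) unfolding ws_def by (metis append_butlast_last_id last_tl list.collapse)
  qed
  have ws: "ws \<noteq> []" "length ws = n - length ys"
    using zs(1) l unfolding eq by auto
  have wsP: "is_path ws" "E (last ys) (hd ws)" "E (last ws) (hd ys)" "last ys \<notin> set ws" "hd ys \<notin> set ws"
    using zs(3) ws(1) unfolding eq by (auto simp: is_path_Cons is_path_append)
  have "set ws \<subseteq> A - set ys"
    using zs(2) wsP(4,5) unfolding eq S_def by auto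
  then have "is_path (ys @ ws)" "set (ys @ ws) \<subseteq> V"
    using ys wsP ws \<open>A \<subseteq> V\<close> by (auto simp: is_path_append)
  then show ?thesis
    unfolding has_cycle_def using ys(2) ws wsP len3
    by (intro exI[of _ "ys @ ws"]) auto
qed

section \<open>Robust pieces\<close>

text \<open>The case \<open>X = Y\<close> covers non-bipartite pieces, the case \<open>X \<inter> Y = {}\<close> bipartite ones.\<close>

definition biregion :: "'a set \<Rightarrow> real \<Rightarrow> 'a set \<Rightarrow> 'a set \<Rightarrow> bool" where
  "biregion V d X Y \<longleftrightarrow> X \<subseteq> V \<and> Y \<subseteq> V \<and> X \<noteq> {} \<and> (X = Y \<or> X \<inter> Y = {}) \<and>
     (\<forall>x\<in>X. d \<le> card (nb x Y)) \<and> (\<forall>y\<in>Y. d \<le> card (nb y X))"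

text \<open>Approximate minimality: the competitors may have degrees lower by \<open>h\<close>, to
  absorb the deletion of few bad vertices, but must not be smaller by \<open>n / 2\<close> or more
  in total size. This gap bounds the number of rounds in the search for a robust pair.\<close>

definition robust :: "'a set \<Rightarrow> real \<Rightarrow> real \<Rightarrow> real \<Rightarrow> 'a set \<Rightarrow> 'a set \<Rightarrow> bool" where
  "robust V n d h X Y \<longleftrightarrow> biregion V d X Y \<and>
     (\<forall>X' Y'. biregion V (d - h) X' Y' \<longrightarrow> real (card X + card Y) < card X' + card Y' + n / 2)"

text \<open>Positivity of \<open>d\<close> gives a vertex of \<open>X\<close> a neighbour in
  \<open>Y\<close>, so \<open>Y\<close> is nonempty too.\<close>

lemma biregion_swap: "biregion V d X Y \<Longrightarrow> 0 < d \<Longrightarrow> biregion V d Y X"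
  unfolding biregion_def by (fastforce simp: nb_def)

lemma robust_swap:
  assumes "robust V n d h X Y" "0 < d" "h < d"
  shows "robust V n d h Y X"
  using assms biregion_swap[of V "d - h"] biregion_swap[of V d X Y]
  unfolding robust_def by (auto simp: add.commute)

text \<open>Replace a pair that is not robust by a witness of this. The total size starts at no more
  than \<open>2 * K * n\<close> and drops by at least \<open>n / 2\<close> per round, while the
  degree bound loses \<open>h\<close>; after \<open>4 * K + 1\<close> rounds the size would be
  negative.\<close>

lemma exists_robust:
  assumes "biregion V (n - h) V V" "card V \<le> K * n" "0 < n"
  shows "\<exists>i X Y. i \<le> 4 * K + 1 \<and> robust V n (n - real (i + 1) * h) h X Y"
proof (rule ccontr)
  assume no: "\<not> ?thesis"
  have "\<exists>X Y. biregion V (n - real (i + 1) * h) X Y \<and> real (card X + card Y) \<le> 2 * real K * real n - real i * real n / 2"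
    if "i \<le> 4 * K + 1" for i
    using that
  proof (induction i)
    case 0
    have "real (card V) \<le> real K * real n"
      using assms(2) by (metis of_nat_mono of_nat_mult)
    then show ?case
      using assms(1) by (intro exI[of _ V]) auto
  next
    case (Suc i)
    then obtain X Y where XY: "biregion V (n - real (i + 1) * h) X Y"
      "real (card X + card Y) \<le> 2 * real K * real n - real i * real n / 2"
      by auto
    then have "\<not> robust V n (n - real (i + 1) * h) h X Y"
      using no Suc.prems by auto
    then obtain X' Y' where "biregion V (n - real (i + 1) * h - h) X' Y'"
      "card X' + card Y' + n / 2 \<le> real (card X + card Y)"
      using XY(1) unfolding robust_def by force
    moreover have eq: "n - real (i + 1) * h - h = n - real (Suc i + 1) * h"
      by (simp add: algebra_simps)
    moreover have "real (card X' + card Y') \<le> 2 * real K * real n - real (Suc i) * real n / 2"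
      using \<open>card X' + card Y' + n / 2 \<le> real (card X + card Y)\<close> XY(2)
      by (simp add: algebra_simps add_divide_distrib)
    ultimately show ?case
      unfolding eq by blast
  qed
  from this[OF order_refl] obtain X Y :: "'a set" where "real (card X + card Y) \<le> 2 * real K * real n - real (4 * K + 1) * real n / 2"
    by blast
  also have "\<dots> < 0"
    using \<open>0 < n\<close> by (simp add: algebra_simps)
  finally show False
    by simp
qed

text \<open>
  If the second neighbourhood \<open>Z2\<close> of \<open>Z\<close> hardly grows, then few edges run between \<open>(Z1, Z)\<close> and its
  complement. After the removal of few bad vertices both sides, or for \<open>X = Y\<close> the pieces cut out
  by \<open>Z1\<close> and \<open>Z\<close>, would be smaller pairs unless the complement is negligible.
\<close>

lemma robust_expand:
  fixes M n d h b t g k :: real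
  assumes fin: "finite V" and V: "card V \<le> M" and rob: "robust V n d h X Y" and "Z \<subseteq> Y"
    and Z1: "Z1 = {x \<in> X. b \<le> card (nb x Z)}" and Z2: "Z2 = {y \<in> Y. b \<le> card (nb y Z1)}"
    and ZZ: "n / 2 \<le> card Z" "card Z2 \<le> card Z + g"
    and const: "0 < b" "b \<le> t" "M * b \<le> t * k" "0 \<le> g" "2 * t + g + 3 * k \<le> h" "h \<le> n / 20" "9 * n / 10 \<le> d"
  shows "Z2 = Y"
proof -
  have XY: "X \<subseteq> V" "Y \<subseteq> V" "X = Y \<or> X \<inter> Y = {}"
    and dX: "\<And>x. x \<in> X \<Longrightarrow> d \<le> card (nb x Y)" and dY: "\<And>y. y \<in> Y \<Longrightarrow> d \<le> card (nb y X)"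
    using rob by (auto simp: robust_def biregion_def)
  have finXY: "finite X" "finite Y" "finite Z" "finite Z1" "finite Z2"
    using finite_subset[OF XY(1) fin] finite_subset[OF XY(2) fin] finite_subset[OF \<open>Z \<subseteq> Y\<close>]
    unfolding Z1 Z2 by simp_all
  have sub: "Z1 \<subseteq> X" "Z2 \<subseteq> Y"
    by (auto simp: Z1 Z2)
  have "0 \<le> M"
    using V of_nat_0_le_iff order_trans by blast
  have "0 < t"
    using const by linarith
  have "0 \<le> k"
  proof -
    have "0 \<le> t * k"
      using const(1,3) \<open>0 \<le> M\<close> mult_nonneg_nonneg[of M b] by linarith
    then show ?thesis
      using \<open>0 < t\<close> by (simp add: zero_le_mult_iff)
  qed
  \<comment> \<open>Double counting across a sparse pair; this is where
    \<open>M * b \<le> t * k\<close> enters.\<close>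
  have few: "real (card P') \<le> k"
    if "finite P" "P' \<subseteq> P" "Q \<subseteq> V" "\<And>q. q \<in> Q \<Longrightarrow> card (nb q P) \<le> b" "\<And>p. p \<in> P' \<Longrightarrow> t \<le> card (nb p Q)"
    for P P' Q
  proof -
    have "finite Q" "card Q \<le> M"
      using that(3) fin V card_mono[OF fin that(3)] finite_subset by fastforce+
    then have "real (card P') * t \<le> real (card Q) * b"
      using card_many_nb_le[OF that(1) _ that(2), of Q b t] that(4,5) by auto
    also have "\<dots> \<le> M * b"
      using \<open>card Q \<le> M\<close> const by (intro mult_right_mono) auto
    also have "\<dots> \<le> k * t"
      using const by (simp add: mult.commute)
    finally show ?thesis
      using \<open>0 < t\<close> by simp
  qed
  \<comment> \<open>The vertices of \<open>Z\<close> and of \<open>Z1\<close> that have many edges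
    across the cut.\<close>
  define B3 where "B3 = {z \<in> Z. t \<le> card (nb z (X - Z1))}"
  define B4 where "B4 = {x \<in> Z1. t \<le> card (nb x (Y - Z2))}"
  have "card B3 \<le> k"
    by (rule few[of Z _ "X - Z1"]) (use finXY XY in \<open>auto simp: B3_def Z1\<close>)
  moreover have "card B4 \<le> k"
    by (rule few[of Z1 _ "Y - Z2"]) (use finXY XY in \<open>auto simp: B4_def Z2\<close>)
  moreover have "real (card (Z2 - Z)) \<le> g + k"
  proof -
    \<comment> \<open>A vertex of \<open>Z\<close> outside \<open>Z2\<close> has fewer than
      \<open>b\<close> neighbours in \<open>Z1\<close>, so almost all of its neighbours lie across
      the cut.\<close>
    have "Z - Z2 \<subseteq> B3"
    proof
      fix z assume z: "z \<in> Z - Z2"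
      have "card (nb z X) \<le> card (nb z (X - Z1)) + card (nb z Z1) + card (nb z {}) + card ({} :: 'a set)"
        using finXY by (intro card_nb_cover) auto
      moreover have "card (nb z Z1) < b" "d \<le> card (nb z X)"
        using z \<open>Z \<subseteq> Y\<close> dY by (auto simp: Z2)
      moreover have "t + b \<le> d"
        using const \<open>0 \<le> k\<close> ZZ by linarith
      ultimately show "z \<in> B3"
        using z by (simp add: B3_def nb_def)
    qed
    then have "card (Z - Z2) \<le> card B3"
      using finXY by (intro card_mono) (auto simp: B3_def)
    moreover have "card Z = card (Z \<inter> Z2) + card (Z - Z2)" "card Z2 = card (Z \<inter> Z2) + card (Z2 - Z)"
      using card_Int_Diff[OF finXY(3), of Z2] card_Int_Diff[OF finXY(5), of Z] by (simp_all add: Int_commute)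
    ultimately show ?thesis
      using ZZ \<open>card B3 \<le> k\<close> by linarith
  qed
  moreover define B where "B = B3 \<union> B4 \<union> (Z2 - Z)"
  moreover have "card B \<le> card B3 + card B4 + card (Z2 - Z)"
    unfolding B_def using card_Un_le[of "B3 \<union> B4" "Z2 - Z"] card_Un_le[of B3 B4] by linarith
  ultimately have cB: "card B \<le> g + 3 * k"
    by linarith
  have finB: "finite B"
    using finXY by (auto simp: B_def B3_def B4_def)

  \<comment> \<open>The four parts of the cut, cleaned of \<open>B\<close>. Every remaining vertex
    has at most \<open>t\<close> neighbours on the wrong side.\<close>
  define U where "U = Z1 - B"
  define U' where "U' = X - Z1 - B"
  define W where "W = Z - B"
  define W' where "W' = Y - Z - B"
  have fins: "finite U" "finite U'" "finite W" "finite W'"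
    using finXY by (auto simp: U_def U'_def W_def W'_def)
  have inXY: "U \<subseteq> X" "U' \<subseteq> X" "W \<subseteq> Y" "W' \<subseteq> Y"
    using sub \<open>Z \<subseteq> Y\<close> by (auto simp: U_def U'_def W_def W'_def)
  have smU: "card (nb v (Y - Z2)) \<le> t" if "v \<in> U" for v
    using that by (auto simp: U_def B_def B4_def)
  have smU': "card (nb v Z) \<le> t" if "v \<in> U'" for v
    using that const(2) by (auto simp: U'_def Z1)
  have smW: "card (nb v (X - Z1)) \<le> t" if "v \<in> W" for v
    using that by (auto simp: W_def B_def B3_def)
  have smW': "card (nb v Z1) \<le> t" if "v \<in> W'" for v
    using that const(2) by (auto simp: W'_def B_def Z2)
  have dh: "0 < d - h" "n / 2 < d - h" "0 < n"
    using const \<open>0 < t\<close> \<open>0 \<le> k\<close> by linarith+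
  \<comment> \<open>Two sparse parts and \<open>B\<close> cost at most
    \<open>2 * t + g + 3 * k \<le> h\<close> neighbours.\<close>
  have loss: "d - h \<le> card (nb v T)"
    if "d \<le> card (nb v S)" "S \<subseteq> T \<union> P \<union> Q \<union> B" "card (nb v P) \<le> t" "card (nb v Q) \<le> t"
      "finite T" "finite P" "finite Q" for v S T P Q
    using card_nb_cover[OF that(2,5-7) finB, of v] that(1,3,4) cB const by linarith
  have nonempty: "d - h \<le> card S" if "d - h \<le> card (nb v S)" "finite S" for v S
    using that card_mono[OF that(2) nb_subset, of v] by linarith
  have small: "real (card X + card Y) < card X' + card Y' + n / 2" if "biregion V (d - h) X' Y'" for X' Y'
    using rob that by (simp add: robust_def)

  have "W \<noteq> {}"
  proof
    assume "W = {}"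
    then have "card Z \<le> card B"
      using finB by (intro card_mono) (auto simp: W_def)
    then show False
      using ZZ cB const \<open>0 < t\<close> dh(3) by linarith
  qed
  have "U' = {}"
    using XY(3)
  proof
    \<comment> \<open>The pair \<open>(U, W)\<close> qualifies as a competitor, so it is almost as
      large as \<open>(X, Y)\<close>. A vertex of \<open>U'\<close> would have more than
      \<open>n / 2\<close> neighbours in \<open>W'\<close>, for which there is no space.\<close>
    assume disj: "X \<inter> Y = {}"
    have W: "d - h \<le> card (nb v U)" if "v \<in> W" for v
      by (rule loss[of v X _ "X - Z1" "{}"])
        (use that smW[OF that] dY inXY finXY \<open>0 < t\<close> in \<open>auto simp: U_def nb_def\<close>)
    have W': "d - h \<le> card (nb v U')" if "v \<in> W'" for v
      by (rule loss[of v X _ "Z1" "{}"])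
        (use that smW'[OF that] dY inXY finXY \<open>0 < t\<close> in \<open>auto simp: U'_def nb_def\<close>)
    have U: "d - h \<le> card (nb v W)" if "v \<in> U" for v
      by (rule loss[of v Y _ "Y - Z2" "{}"])
        (use that smU[OF that] dX inXY finXY \<open>0 < t\<close> fins in \<open>auto simp: W_def B_def nb_def\<close>)
    have U': "d - h \<le> card (nb v W')" if "v \<in> U'" for v
      by (rule loss[of v Y _ "Z" "{}"])
        (use that smU'[OF that] dX inXY finXY \<open>0 < t\<close> in \<open>auto simp: W'_def nb_def\<close>)
    obtain w where "w \<in> W"
      using \<open>W \<noteq> {}\<close> by blast
    then have "U \<noteq> {}"
      using W[of w] dh by (auto simp: nb_def)
    have "biregion V (d - h) U W"
      unfolding biregion_def using W U inXY XY(1,2) disj \<open>U \<noteq> {}\<close> by blast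
    then have lt: "real (card X + card Y) < card U + card W + n / 2"
      by (rule small)
    show ?thesis
    proof (rule ccontr)
      assume "U' \<noteq> {}"
      then obtain v where "v \<in> U'"
        by blast
      then have "d - h \<le> card W'"
        using nonempty[OF U'] fins by blast
      moreover have "card W + card W' \<le> card Y"
        using fins finXY inXY card_mono[of Y "W \<union> W'"] by (subst card_Un_disjoint[symmetric]) (auto simp: W_def W'_def)
      moreover have "card U \<le> card X"
        using finXY inXY by (intro card_mono) auto
      ultimately show False
        using lt dh by linarith
    qed
  next
    assume eq: "X = Y"
    \<comment> \<open>For \<open>X = Y\<close> the set is cut in two ways. The parts
      \<open>U \<inter> W\<close> and \<open>U' \<inter> W'\<close> keep their neighbours inside,
      while the crossed parts \<open>U \<inter> W'\<close> and \<open>W \<inter> U'\<close> are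
      joined to each other.\<close>
    have I: "d - h \<le> card (nb v (U \<inter> W))" if "v \<in> U \<inter> W" for v
      by (rule loss[of v X _ "X - Z1" "Y - Z2"])
        (use that smW[of v] smU[of v] dY inXY finXY fins in \<open>auto simp: U_def W_def B_def eq\<close>)
    have O: "d - h \<le> card (nb v (U' \<inter> W'))" if "v \<in> U' \<inter> W'" for v
      by (rule loss[of v X _ Z1 Z])
        (use that smW'[of v] smU'[of v] dY inXY finXY fins in \<open>auto simp: U'_def W'_def eq\<close>)
    have S: "d - h \<le> card (nb v (W \<inter> U'))" if "v \<in> U \<inter> W'" for v
      by (rule loss[of v X _ Z1 "Y - Z2"])
        (use that smW'[of v] smU[of v] dY inXY finXY fins in \<open>auto simp: U'_def W_def B_def eq\<close>)
    have T: "d - h \<le> card (nb v (U \<inter> W'))" if "v \<in> W \<inter> U'" for v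
      by (rule loss[of v X _ "X - Z1" Z])
        (use that smW[of v] smU'[of v] dY inXY finXY fins in \<open>auto simp: U_def W'_def eq\<close>)
    \<comment> \<open>The crossed parts would form a disjoint pair of total size at most
      \<open>card X\<close>, which falls short of \<open>card X + card Y\<close> by at least
      \<open>d\<close>.\<close>
    have empty: "U \<inter> W' = {}"
    proof (rule ccontr)
      assume "U \<inter> W' \<noteq> {}"
      moreover have disj: "(U \<inter> W') \<inter> (W \<inter> U') = {}"
        by (auto simp: W_def W'_def)
      ultimately have "biregion V (d - h) (U \<inter> W') (W \<inter> U')"
        unfolding biregion_def using S T inXY XY(1,2) by (intro conjI ballI) auto
      then have "real (card X + card Y) < card (U \<inter> W') + card (W \<inter> U') + n / 2"
        by (rule small)
      moreover have "card (U \<inter> W') + card (W \<inter> U') \<le> card Y"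
        using fins finXY inXY card_mono[of Y "U \<inter> W' \<union> W \<inter> U'"] disj by (subst card_Un_disjoint[symmetric]) auto
      moreover obtain v where "v \<in> U \<inter> W'"
        using \<open>U \<inter> W' \<noteq> {}\<close> by blast
      then have "d \<le> card (nb v Y)"
        using dX inXY by blast
      then have "d \<le> card Y"
        using card_mono[OF finXY(2) nb_subset, of v] by linarith
      ultimately show False
        using eq dh const \<open>0 < t\<close> \<open>0 \<le> k\<close> by simp
    qed
    have empty': "W \<inter> U' = {}"
    proof (rule ccontr)
      assume "W \<inter> U' \<noteq> {}"
      then obtain v where "v \<in> W \<inter> U'"
        by blast
      then have "d - h \<le> card (nb v {})"
        using T[of v] empty by simp
      then show False
        using dh by (simp add: nb_def)
    qed
    have W_U: "W \<subseteq> U" and U'_W': "U' \<subseteq> W'"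
      using empty empty' inXY by (auto simp: W_def U_def U'_def W'_def eq)
    have "biregion V (d - h) (U \<inter> W) (U \<inter> W)"
      unfolding biregion_def using I inXY XY(1,2) W_U \<open>W \<noteq> {}\<close> by (intro conjI ballI) auto
    then have lt: "real (card X + card Y) < card (U \<inter> W) + card (U \<inter> W) + n / 2"
      by (rule small)
    show ?thesis
    proof (rule ccontr)
      assume "U' \<noteq> {}"
      then obtain v where "v \<in> U' \<inter> W'"
        using U'_W' by blast
      then have "d - h \<le> card (U' \<inter> W')"
        using nonempty[OF O] fins by blast
      moreover have "card (U \<inter> W) + card (U' \<inter> W') \<le> card X"
        using fins finXY inXY card_mono[of X "U \<inter> W \<union> U' \<inter> W'"]
        by (subst card_Un_disjoint[symmetric]) (auto simp: W_def W'_def)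
      ultimately show False
        using lt dh eq by simp
    qed
  qed
  then have "X - Z1 \<subseteq> B"
    by (auto simp: U'_def)
  \<comment> \<open>Since \<open>Z1\<close> misses only vertices of \<open>B\<close> in
    \<open>X\<close>, every \<open>y\<close> keeps at least \<open>d - h \<ge> b\<close> neighbours
    in it.\<close>
  have "y \<in> Z2" if y: "y \<in> Y" for y
  proof -
    have "d - h \<le> card (nb y Z1)"
      by (rule loss[of y X _ "{}" "{}"])
        (use \<open>X - Z1 \<subseteq> B\<close> y dY finXY \<open>0 < t\<close> in \<open>auto simp: nb_def\<close>)
    moreover have "b \<le> d - h"
      using const \<open>0 \<le> k\<close> dh by linarith
    ultimately show ?thesis
      using y by (simp add: Z2)
  qed
  then show ?thesis
    using sub by blast
qed

section \<open>Links of one fixed length\<close>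

text \<open>Level \<open>i\<close> consists of vertices from which \<open>r\<close> is reached in
  \<open>i + 1\<close> edges with at least \<open>b\<close> choices for each step but the last, so
  that a small set can be avoided. Even levels lie in \<open>Y\<close>, odd ones in
  \<open>X\<close>.\<close>

primrec lev :: "'a \<Rightarrow> 'a set \<Rightarrow> 'a set \<Rightarrow> real \<Rightarrow> nat \<Rightarrow> 'a set" where
  "lev r X Y b 0 = nb r Y"
| "lev r X Y b (Suc i) = {v \<in> (if even i then X else Y). b \<le> card (nb v (lev r X Y b i))}"

lemma lev_subset: "lev r X Y b i \<subseteq> (if even i then Y else X)"
  by (cases i) (auto simp: nb_def)

text \<open>By \<open>robust_expand\<close> an even level that is not all of \<open>Y\<close> is
  followed by one that is all of \<open>Y\<close> or larger by more than \<open>g\<close>; as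
  \<open>real J * g \<ge> M\<close>, this growth cannot last for \<open>J\<close> rounds. A full
  level stays full because \<open>b \<le> d\<close>.\<close>

lemma lev_full:
  fixes M n d h b t g k :: real
  assumes fin: "finite V" and V: "card V \<le> M" and rob: "robust V n d h X Y" and r: "r \<in> X"
    and const: "0 < b" "b \<le> t" "M * b \<le> t * k" "0 \<le> g" "2 * t + g + 3 * k \<le> h" "h \<le> n / 20" "9 * n / 10 \<le> d"
    and "0 < n" "b \<le> d" "M \<le> real J * g"
  shows "lev r X Y b (2 * J) = Y"
proof -
  have XY: "X \<subseteq> V" "Y \<subseteq> V"
    and dX: "\<And>x. x \<in> X \<Longrightarrow> d \<le> card (nb x Y)" and dY: "\<And>y. y \<in> Y \<Longrightarrow> d \<le> card (nb y X)"
    using rob by (auto simp: robust_def biregion_def)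
  have "lev r X Y b (2 * i) = Y \<or> n / 2 + real i * g \<le> card (lev r X Y b (2 * i))" for i
  proof (induction i)
    case 0
    have "n / 2 \<le> card (nb r Y)"
      using dX[OF r] const \<open>0 < n\<close> by linarith
    then show ?case
      by simp
  next
    case (Suc i)
    let ?Z = "lev r X Y b (2 * i)"
    have sub: "?Z \<subseteq> Y"
      using lev_subset[of r X Y b "2 * i"] by simp
    define Z1 where "Z1 = {x \<in> X. b \<le> card (nb x ?Z)}"
    have eq: "lev r X Y b (2 * Suc i) = {y \<in> Y. b \<le> card (nb y Z1)}"
      by (simp add: Z1_def)
    show ?case
    proof (cases "?Z = Y")
      case True
      then have "Z1 = X"
        unfolding Z1_def using dX \<open>b \<le> d\<close> by force
      then show ?thesis
        unfolding eq using dY \<open>b \<le> d\<close> by force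
    next
      case False
      then have Z: "n / 2 + real i * g \<le> card ?Z"
        using Suc.IH by blast
      show ?thesis
      proof (cases "card (lev r X Y b (2 * Suc i)) \<le> card ?Z + g")
        case True
        have "0 \<le> real i * g"
          using \<open>0 \<le> g\<close> by simp
        then have "n / 2 \<le> card ?Z"
          using Z by linarith
        then have "lev r X Y b (2 * Suc i) = Y"
          using robust_expand[OF fin V rob sub Z1_def eq _ True const] by blast
        then show ?thesis ..
      next
        case False
        then show ?thesis
          using Z by (simp add: algebra_simps)
      qed
    qed
  qed
  moreover have "card (lev r X Y b (2 * J)) \<le> M"
    using V card_mono[OF fin, of "lev r X Y b (2 * J)"] lev_subset[of r X Y b "2 * J"] XY by fastforce
  ultimately show ?thesis
    using \<open>M \<le> real J * g\<close> \<open>0 < n\<close> by (smt (verit) half_gt_zero)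
qed

text \<open>Descend greedily. Each step adds the vertex it leaves to the forbidden set
  \<open>F\<close> and lowers \<open>i\<close> by one, so the bound on \<open>card F + i\<close> is
  preserved.\<close>

lemma link_lev:
  fixes b :: real
  assumes "v \<in> lev r X Y b i" "finite F" "finite (X \<union> Y)" "card F + i + 1 < b" "v \<notin> F" "r \<notin> F" "v \<noteq> r"
  shows "\<exists>xs. is_path xs \<and> length xs = i + 2 \<and> hd xs = v \<and> last xs = r \<and> set xs \<inter> F = {} \<and>
    set xs \<subseteq> {v, r} \<union> X \<union> Y"
  using assms
proof (induction i arbitrary: v F)
  case 0
  then show ?case
    using sym[of r v] by (intro exI[of _ "[v, r]"]) (auto simp: is_path_def nb_def)
next
  case (Suc i)
  let ?N = "nb v (lev r X Y b i)"
  have fin: "finite ?N"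
    using Suc.prems(3) by (intro finite_nb finite_subset[OF lev_subset]) auto
  have "b \<le> card ?N"
    using Suc.prems(1) by simp
  then have "card (insert r F) < card ?N"
    using Suc.prems(2,4) card_insert_le_m1[of "card F + 1" F r] by simp
  then have "\<not> ?N \<subseteq> insert r F"
    using card_mono[of "insert r F" ?N] Suc.prems(2) by auto
  then obtain u where u: "u \<in> lev r X Y b i" "E v u" "u \<notin> F" "u \<noteq> r"
    by (auto simp: nb_def)
  have "u \<noteq> v"
    using u irrefl by blast
  have "\<exists>xs. is_path xs \<and> length xs = i + 2 \<and> hd xs = u \<and> last xs = r \<and> set xs \<inter> insert v F = {} \<and>
    set xs \<subseteq> {u, r} \<union> X \<union> Y"
    using Suc.prems u \<open>u \<noteq> v\<close> by (intro Suc.IH) auto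
  then obtain xs where xs: "is_path xs" "length xs = i + 2" "hd xs = u" "last xs = r"
    "set xs \<inter> insert v F = {}" "set xs \<subseteq> {u, r} \<union> X \<union> Y"
    by blast
  have "u \<in> X \<union> Y"
    using u(1) lev_subset[of r X Y b i] by (auto split: if_splits)
  then show ?case
    using xs u Suc.prems(5) by (intro exI[of _ "v # xs"]) (auto simp: is_path_Cons)
qed

text \<open>Greedy choice: some vertex of \<open>Y\<close> is adjacent to at least a fraction
  \<open>\<theta>\<close> of the vertices not yet dominated.\<close>

lemma dominating_subset:
  fixes \<theta> :: real
  assumes fin: "finite X" "finite Y" and "Y \<noteq> {}"
    and \<theta>: "\<theta> \<le> 1" and dom: "\<And>x. x \<in> X \<Longrightarrow> \<theta> * card Y \<le> card (nb x Y)"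
  shows "\<exists>R\<subseteq>Y. card R \<le> m \<and> card {x \<in> X. nb x R = {}} \<le> (1 - \<theta>) ^ m * card X"
proof (induction m)
  case 0
  then show ?case
    by (intro exI[of _ "{}"]) (simp add: nb_def)
next
  case (Suc m)
  then obtain R where R: "R \<subseteq> Y" "card R \<le> m" "card {x \<in> X. nb x R = {}} \<le> (1 - \<theta>) ^ m * card X"
    by blast
  define U where "U = {x \<in> X. nb x R = {}}"
  have U: "finite U" "U \<subseteq> X"
    using fin by (auto simp: U_def)
  \<comment> \<open>Averaging over \<open>Y\<close>, after the edges to \<open>U\<close> are counted
    from both sides.\<close>
  have "\<exists>y\<in>Y. \<theta> * card U \<le> card (nb y U)"
  proof (rule ccontr)
    assume "\<not> ?thesis"
    then have "(\<Sum>y\<in>Y. real (card (nb y U))) < (\<Sum>y\<in>Y. \<theta> * card U)"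
      using fin \<open>Y \<noteq> {}\<close> by (intro sum_strict_mono) auto
    moreover have "(\<Sum>y\<in>Y. real (card (nb y U))) = (\<Sum>u\<in>U. real (card (nb u Y)))"
      using sum_card_nb[OF fin(2) U(1)] by (metis of_nat_sum)
    moreover have "(\<Sum>u\<in>U. \<theta> * card Y) \<le> (\<Sum>u\<in>U. real (card (nb u Y)))"
      using dom U by (intro sum_mono) auto
    ultimately show False
      by (simp add: mult.commute mult.left_commute)
  qed
  then obtain y where y: "y \<in> Y" "\<theta> * card U \<le> card (nb y U)"
    by blast
  have "{x \<in> X. nb x (insert y R) = {}} \<subseteq> U - nb y U"
    using sym by (auto simp: U_def nb_def)
  then have "card {x \<in> X. nb x (insert y R) = {}} \<le> card (U - nb y U)"
    using U by (intro card_mono) auto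
  also have "\<dots> = card U - card (nb y U)"
    using U by (intro card_Diff_subset) (auto simp: nb_def)
  finally have "real (card {x \<in> X. nb x (insert y R) = {}}) \<le> (1 - \<theta>) * card U"
    using y(2) card_mono[OF U(1) nb_subset, of y] by (simp add: algebra_simps)
  also have "\<dots> \<le> (1 - \<theta>) * ((1 - \<theta>) ^ m * card X)"
    using R(3) \<theta> by (intro mult_left_mono) (auto simp: U_def)
  finally show ?case
    using R y card_insert_le_m1[of "Suc m" R y]
    by (intro exI[of _ "insert y R"]) (auto simp: mult.assoc)
qed

section \<open>Long paths in connected graphs of large minimum degree\<close>

text \<open>All neighbours of the ends of a longest path lie on it. If it had fewer than
  \<open>l\<close> vertices, a crossing of two such edges would turn it into a cycle on the same
  vertices, and an edge leaving that cycle would give a longer path.\<close>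

lemma long_path:
  assumes A: "finite A" "l \<le> card A" "A \<noteq> {}"
    and deg: "\<And>v. v \<in> A \<Longrightarrow> l \<le> 2 * card (nb v A)"
    and conn: "\<And>C. C \<subseteq> A \<Longrightarrow> C \<noteq> {} \<Longrightarrow> C \<noteq> A \<Longrightarrow> \<exists>c\<in>C. \<exists>u\<in>A - C. E c u"
  shows "\<exists>xs. is_path xs \<and> length xs = l \<and> set xs \<subseteq> A"
proof -
  let ?P = "\<lambda>xs. is_path xs \<and> xs \<noteq> [] \<and> set xs \<subseteq> A"
  obtain a where "a \<in> A"
    using A by blast
  then have "?P [a]"
    by (simp add: is_path_def)
  moreover have "length xs < Suc (card A)" if "?P xs" for xs
    using that A card_mono[of A "set xs"] by (auto simp: is_path_def distinct_card)
  ultimately obtain xs where xs: "is_path xs" "xs \<noteq> []" "set xs \<subseteq> A"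
    and max: "\<And>ys. ?P ys \<Longrightarrow> length ys \<le> length xs"
    using ex_has_greatest_nat[of ?P "[a]" length "Suc (card A)"] by blast
  show ?thesis
  proof (cases "l \<le> length xs")
    case True
    have "xs = take l xs @ drop l xs"
      by simp
    then have "is_path (take l xs)"
      using xs(1) is_path_append by metis
    then show ?thesis
      using True xs(3) set_take_subset[of l xs] by (intro exI[of _ "take l xs"]) auto
  next
    case False
    define t where "t = length xs - 1"
    have t: "length xs = Suc t"
      using xs(2) by (simp add: t_def)
    have dist: "distinct xs"
      using xs(1) by (simp add: is_path_def)
    have hd_in: "u \<in> set xs" if "u \<in> A" "E u (hd xs)" for u
    proof (rule ccontr)
      assume "u \<notin> set xs"
      then have "?P (u # xs)"
        using xs that by (simp add: is_path_Cons)
      then show False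
        using max by fastforce
    qed
    have last_in: "u \<in> set xs" if "u \<in> A" "E (last xs) u" for u
    proof (rule ccontr)
      assume "u \<notin> set xs"
      then have "?P (xs @ [u])"
        using xs that by (simp add: is_path_append) (simp add: is_path_def)
      then show False
        using max by fastforce
    qed
    \<comment> \<open>\<open>I\<close> holds the predecessors of the neighbours of the first vertex,
      \<open>J\<close> the neighbours of the last. Together they number at least
      \<open>l > t\<close>, so they share a position.\<close>
    define I where "I = {i. i < t \<and> E (hd xs) (xs ! Suc i)}"
    define J where "J = {i. i < t \<and> E (last xs) (xs ! i)}"
    have hd0: "hd xs = xs ! 0" and lastt: "last xs = xs ! t"
      using xs(2) t by (auto simp: hd_conv_nth last_conv_nth)
    have "nb (hd xs) A \<subseteq> (\<lambda>i. xs ! Suc i) ` I"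
    proof
      fix u assume "u \<in> nb (hd xs) A"
      then have u: "u \<in> A" "E (hd xs) u"
        by (auto simp: nb_def)
      then have "u \<in> set xs"
        using hd_in sym by blast
      then obtain i where i: "i < Suc t" "xs ! i = u"
        using t by (metis in_set_conv_nth)
      then have "i \<noteq> 0"
        using u irrefl hd0 by metis
      then obtain i' where "i = Suc i'"
        using not0_implies_Suc by blast
      then show "u \<in> (\<lambda>i. xs ! Suc i) ` I"
        using i u unfolding I_def by auto
    qed
    then have I: "card (nb (hd xs) A) \<le> card I"
      by (rule surj_card_le[rotated]) (simp add: I_def)
    have "nb (last xs) A \<subseteq> (!) xs ` J"
    proof
      fix u assume "u \<in> nb (last xs) A"
      then have u: "u \<in> A" "E (last xs) u"
        by (auto simp: nb_def)
      then have "u \<in> set xs"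
        using last_in by blast
      then obtain i where i: "i < Suc t" "xs ! i = u"
        using t by (metis in_set_conv_nth)
      then have "i \<noteq> t"
        using u irrefl lastt by metis
      then show "u \<in> (!) xs ` J"
        using i u unfolding J_def by auto
    qed
    then have J: "card (nb (last xs) A) \<le> card J"
      by (rule surj_card_le[rotated]) (simp add: J_def)
    have "hd xs \<in> A" "last xs \<in> A"
      using xs by auto
    then have "l \<le> card I + card J"
      using deg[of "hd xs"] deg[of "last xs"] I J by linarith
    moreover have "card (I \<union> J) \<le> t"
      using card_mono[of "{..<t}" "I \<union> J"] by (auto simp: I_def J_def)
    moreover have "card I + card J = card (I \<union> J) + card (I \<inter> J)"
      by (rule card_Un_Int) (auto simp: I_def J_def)
    ultimately have "card (I \<inter> J) \<noteq> 0"
      using False t by linarith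
    then have "I \<inter> J \<noteq> {}"
      by (metis card.empty)
    then obtain i where i: "i < t" "E (hd xs) (xs ! Suc i)" "E (last xs) (xs ! i)"
      unfolding I_def J_def by blast
    \<comment> \<open>Reversing the part after \<open>xs ! i\<close> makes \<open>xs ! Suc i\<close>
      the last vertex, which is adjacent to the first.\<close>
    define ys where "ys = take (Suc i) xs @ rev (drop (Suc i) xs)"
    have set_ys: "set ys = set xs"
      unfolding ys_def using set_append[of "take (Suc i) xs" "drop (Suc i) xs"] by simp
    have "is_path (take (Suc i) xs @ drop (Suc i) xs)"
      using xs(1) by simp
    moreover have "last (take (Suc i) xs) = xs ! i"
      using i t by (simp add: take_Suc_conv_app_nth)
    moreover have "hd (rev (drop (Suc i) xs)) = last xs"
      using i t by (simp add: hd_rev last_drop)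
    ultimately have "is_path ys"
      unfolding ys_def is_path_append is_path_rev using sym[OF i(3)] by auto
    have last_ys: "last ys = xs ! Suc i"
      using i t by (simp add: ys_def last_rev hd_drop_conv_nth)
    have hd_ys: "hd ys = hd xs"
      using xs(2) by (simp add: ys_def)
    have "set xs \<noteq> A"
      using distinct_card[OF dist] False A(2) by auto
    then obtain c u where c: "c \<in> set xs" "u \<in> A" "u \<notin> set xs" "E c u"
      using conn[of "set xs"] xs by auto
    obtain ps qs where split: "ys = ps @ c # qs"
      using c(1) set_ys split_list by metis
    have E: "E (last ys) (hd ys)"
      using i(2) sym last_ys hd_ys by metis
    \<comment> \<open>The cycle is cut open so that it starts at \<open>c\<close>, where
      \<open>u\<close> can be put in front.\<close>
    have "is_path ((c # qs) @ ps)"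
      using \<open>is_path ys\<close> E unfolding split is_path_append by (cases ps) auto
    then have "?P (u # (c # qs) @ ps)"
      using c set_ys xs(3) sym[OF c(4)] unfolding split by (auto simp: is_path_Cons)
    moreover have "length (u # (c # qs) @ ps) = Suc (length xs)"
      using arg_cong[OF split, of length] i t by (simp add: ys_def)
    ultimately show ?thesis
      using max by fastforce
  qed
qed

text \<open>Disjointness makes the sides alternate, so positions of equal parity lie on the same
  side.\<close>

lemma alternating_last:
  assumes "successively (\<lambda>u v. u \<in> X \<and> v \<in> Y \<or> u \<in> Y \<and> v \<in> X) xs" "X \<inter> Y = {}"
    "odd (length xs)" "hd xs \<in> X"
  shows "last xs \<in> X"
  using assms
proof (induction xs rule: induct_list012)
  case (3 u w zs)
  show ?case
  proof (cases zs)
    case Nil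
    then show ?thesis
      using "3.prems" by simp
  next
    case (Cons z zs')
    then have "hd zs \<in> X"
      using "3.prems" by auto
    then show ?thesis
      using "3.IH"(1) "3.prems" Cons by auto
  qed
qed auto

text \<open>Level \<open>2 * J\<close> is all of \<open>Y\<close>, so every \<open>s\<close> in
  \<open>X\<close> lies on level \<open>2 * J + 1\<close>. The length is the same for all pairs of
  ends.\<close>

lemma robust_link:
  fixes M n d h b t g k :: real
  assumes fin: "finite V" and V: "card V \<le> M" and rob: "robust V n d h X Y"
    and const: "0 < b" "b \<le> t" "M * b \<le> t * k" "0 \<le> g" "2 * t + g + 3 * k \<le> h" "h \<le> n / 20" "9 * n / 10 \<le> d"
    and "0 < n" "b \<le> d" "M \<le> real J * g" and Jb: "2 * J + 2 < b"
    and rs: "r \<in> X" "s \<in> X" "r \<noteq> s"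
  shows "\<exists>xs. is_path xs \<and> length xs = 2 * J + 3 \<and> hd xs = s \<and> last xs = r \<and> set xs \<subseteq> V"
proof -
  have XY: "X \<subseteq> V" "Y \<subseteq> V" and dX: "\<And>x. x \<in> X \<Longrightarrow> d \<le> card (nb x Y)"
    using rob by (auto simp: robust_def biregion_def)
  have "lev r X Y b (2 * J) = Y"
    using lev_full[OF fin V rob rs(1) const assms(11-13)] .
  then have s: "s \<in> lev r X Y b (Suc (2 * J))"
    using dX[OF rs(2)] rs(2) \<open>b \<le> d\<close> by simp
  have finXY: "finite (X \<union> Y)"
    using finite_subset[OF XY(1) fin] finite_subset[OF XY(2) fin] by simp
  have "real (card ({} :: 'a set) + Suc (2 * J) + 1) < b"
    using Jb by simp
  from link_lev[OF s _ finXY this] rs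
  obtain xs where "is_path xs" "length xs = Suc (2 * J) + 2" "hd xs = s" "last xs = r" "set xs \<subseteq> {s, r} \<union> X \<union> Y"
    by blast
  then show ?thesis
    using rs XY(1,2) by (intro exI[of _ xs] conjI) auto
qed

text \<open>If no edge left \<open>C\<close>, its traces on \<open>X\<close> and \<open>Y\<close>
  would be a competing pair, as \<open>D\<close> costs at most \<open>h\<close> neighbours.
  Robustness then makes them too large to leave space for the neighbours of a vertex outside
  \<open>C\<close>.\<close>

lemma robust_conn:
  fixes n d h :: real
  assumes fin: "finite V" and rob: "robust V n d h X Y"
    and D: "finite D" "card D \<le> h" and dh: "n / 2 < d - h" "0 < d - h"
    and C: "C \<subseteq> (X \<union> Y) - D" "C \<noteq> {}" "C \<noteq> (X \<union> Y) - D"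
  shows "\<exists>c\<in>C. \<exists>u\<in>(X \<union> Y) - D - C. E c u \<and> (c \<in> X \<and> u \<in> Y \<or> c \<in> Y \<and> u \<in> X)"
proof (rule ccontr)
  assume no: "\<not> ?thesis"
  have XY: "X \<subseteq> V" "Y \<subseteq> V" "X = Y \<or> X \<inter> Y = {}"
    and dX: "\<And>x. x \<in> X \<Longrightarrow> d \<le> card (nb x Y)" and dY: "\<And>y. y \<in> Y \<Longrightarrow> d \<le> card (nb y X)"
    using rob by (auto simp: robust_def biregion_def)
  have finXY: "finite X" "finite Y"
    using finite_subset[OF XY(1) fin] finite_subset[OF XY(2) fin] by simp_all
  have X1: "d - h \<le> card (nb v (Y - D))" if "v \<in> X" for v
  proof -
    have "card (nb v Y) \<le> card (nb v (Y - D)) + card (nb v {}) + card (nb v {}) + card D"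
      using finXY D by (intro card_nb_cover) auto
    then show ?thesis
      using dX[OF that] D by (simp add: nb_def)
  qed
  have Y1: "d - h \<le> card (nb v (X - D))" if "v \<in> Y" for v
  proof -
    have "card (nb v X) \<le> card (nb v (X - D)) + card (nb v {}) + card (nb v {}) + card D"
      using finXY D by (intro card_nb_cover) auto
    then show ?thesis
      using dY[OF that] D by (simp add: nb_def)
  qed
  have X2: "nb v (Y - D) \<subseteq> C" if "v \<in> X" "v \<in> C" for v
    using no that unfolding nb_def by blast
  have Y2: "nb v (X - D) \<subseteq> C" if "v \<in> Y" "v \<in> C" for v
    using no that unfolding nb_def by blast
  have X3: "d - h \<le> card (nb v (Y \<inter> C))" if "v \<in> X" "v \<in> C" for v
    using X1[OF that(1)] card_mono[of "nb v (Y \<inter> C)" "nb v (Y - D)"] X2[OF that] finXY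
    by (force simp: nb_def)
  have Y3: "d - h \<le> card (nb v (X \<inter> C))" if "v \<in> Y" "v \<in> C" for v
    using Y1[OF that(1)] card_mono[of "nb v (X \<inter> C)" "nb v (X - D)"] Y2[OF that] finXY
    by (force simp: nb_def)
  have "X \<inter> C \<noteq> {}"
  proof
    assume *: "X \<inter> C = {}"
    then obtain c where "c \<in> Y" "c \<in> C"
      using C by auto
    then show False
      using Y3[of c] dh * by (simp add: nb_def)
  qed
  then have "biregion V (d - h) (X \<inter> C) (Y \<inter> C)"
    using X3 Y3 XY unfolding biregion_def by auto
  then have lt: "real (card X + card Y) < card (X \<inter> C) + card (Y \<inter> C) + n / 2"
    using rob by (simp add: robust_def)
  obtain v where v: "v \<in> (X \<union> Y) - D" "v \<notin> C"
    using C by blast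
  show False
  proof (cases "v \<in> X")
    case True
    have "nb v (Y - D) \<inter> C = {}"
      using no v True sym unfolding nb_def by blast
    then have "card (Y \<inter> C) + card (nb v (Y - D)) \<le> card Y"
      using finXY card_mono[of Y "Y \<inter> C \<union> nb v (Y - D)"]
      by (subst card_Un_disjoint[symmetric]) (auto simp: nb_def)
    moreover have "card (X \<inter> C) \<le> card X"
      using finXY by (intro card_mono) auto
    ultimately show False
      using lt X1[OF True] dh by linarith
  next
    case False
    then have "v \<in> Y"
      using v by blast
    have "nb v (X - D) \<inter> C = {}"
      using no v \<open>v \<in> Y\<close> sym unfolding nb_def by blast
    then have "card (X \<inter> C) + card (nb v (X - D)) \<le> card X"
      using finXY card_mono[of X "X \<inter> C \<union> nb v (X - D)"]
      by (subst card_Un_disjoint[symmetric]) (auto simp: nb_def)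
    moreover have "card (Y \<inter> C) \<le> card Y"
      using finXY by (intro card_mono) auto
    ultimately show False
      using lt Y1[OF \<open>v \<in> Y\<close>] dh by linarith
  qed
qed

lemma robust_long_path:
  fixes n d h :: real
  assumes fin: "finite V" and rob: "robust V n d h X Y"
    and D: "finite D" "card D \<le> h" and dh: "n / 2 < d - h" "0 < d - h"
    and l: "0 < l" "l \<le> n" "l + card D \<le> card (X \<union> Y)"
  shows "\<exists>xs. is_path xs \<and> length xs = l \<and> set xs \<subseteq> (X \<union> Y) - D \<and>
    successively (\<lambda>u v. u \<in> X \<and> v \<in> Y \<or> u \<in> Y \<and> v \<in> X) xs"
proof -
  \<comment> \<open>Only edges between the two sides are kept, so that the path alternates if
    \<open>X\<close> and \<open>Y\<close> are disjoint.\<close>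
  define R where "R = (\<lambda>u v. E u v \<and> (u \<in> X \<and> v \<in> Y \<or> u \<in> Y \<and> v \<in> X))"
  interpret R: graph_rel R
    by unfold_locales (auto simp: R_def irrefl intro: sym)
  have XY: "X \<subseteq> V" "Y \<subseteq> V" "X = Y \<or> X \<inter> Y = {}"
    and dX: "\<And>x. x \<in> X \<Longrightarrow> d \<le> card (nb x Y)" and dY: "\<And>y. y \<in> Y \<Longrightarrow> d \<le> card (nb y X)"
    using rob by (auto simp: robust_def biregion_def)
  have finXY: "finite X" "finite Y"
    using finite_subset[OF XY(1) fin] finite_subset[OF XY(2) fin] by simp_all
  let ?A = "(X \<union> Y) - D"
  have "card (X \<union> Y) - card D \<le> card ?A"
    using D by (simp add: diff_card_le_card_Diff)
  then have "l \<le> card ?A"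
    using l by linarith
  then have "card ?A \<noteq> 0"
    using l(1) by linarith
  then have "?A \<noteq> {}"
    by (metis card.empty)
  have deg: "l \<le> 2 * card (R.nb v ?A)" if v: "v \<in> ?A" for v
  proof -
    have "\<exists>Z. Z \<subseteq> X \<union> Y \<and> d \<le> card (nb v Z) \<and> nb v (Z - D) \<subseteq> R.nb v ?A"
    proof (cases "v \<in> X")
      case True
      then show ?thesis
        using dX unfolding R.nb_def by (intro exI[of _ Y]) (auto simp: nb_def R_def)
    next
      case False
      then show ?thesis
        using dY v unfolding R.nb_def by (intro exI[of _ X]) (auto simp: nb_def R_def)
    qed
    then obtain Z where Z: "Z \<subseteq> X \<union> Y" "d \<le> card (nb v Z)" "nb v (Z - D) \<subseteq> R.nb v ?A"
      by blast
    have "card (nb v Z) \<le> card (nb v (Z - D)) + card (nb v {}) + card (nb v {}) + card D"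
      using finXY D Z(1) finite_subset[of Z "X \<union> Y"] by (intro card_nb_cover) auto
    moreover have "card (nb v (Z - D)) \<le> card (R.nb v ?A)"
      using finXY Z(3) by (intro card_mono) auto
    ultimately have "n / 2 < card (R.nb v ?A)"
      using Z(2) D dh by (simp add: nb_def)
    then show ?thesis
      using l by linarith
  qed
  have conn: "\<exists>c\<in>C. \<exists>u\<in>?A - C. R c u" if "C \<subseteq> ?A" "C \<noteq> {}" "C \<noteq> ?A" for C
    using robust_conn[OF fin rob D dh that] unfolding R_def by blast
  obtain xs where xs: "R.is_path xs" "length xs = l" "set xs \<subseteq> ?A"
    using R.long_path[OF _ \<open>l \<le> card ?A\<close> \<open>?A \<noteq> {}\<close> deg conn] finXY by auto
  have succ: "successively R xs"
    using xs(1) by (simp add: R.is_path_def)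
  have "successively E xs"
    by (rule successively_mono[OF succ]) (simp add: R_def)
  moreover have "successively (\<lambda>u v. u \<in> X \<and> v \<in> Y \<or> u \<in> Y \<and> v \<in> X) xs"
    by (rule successively_mono[OF succ]) (simp add: R_def)
  ultimately show ?thesis
    using xs unfolding R.is_path_def is_path_def by blast
qed

text \<open>
  The links between \<open>R1\<close> and \<open>R2\<close> are fixed before the long path is chosen, so that the path can avoid
  them. Both ends of the segment must lie in \<open>X\<close>: this is where \<open>n\<close> has to be even.
\<close>

lemma cycle_if_robust:
  fixes M d h b t g k \<theta> :: real
  assumes fin: "finite V" and V: "card V \<le> M" and rob: "robust V n d h X Y"
    and const: "0 < b" "b \<le> t" "M * b \<le> t * k" "0 \<le> g" "2 * t + g + 3 * k \<le> h" "h \<le> n / 20" "9 * n / 10 \<le> d"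
    and J: "b \<le> d" "M \<le> real J * g" "2 * J + 2 < b"
    and \<theta>: "0 \<le> \<theta>" "\<theta> \<le> 1" "\<theta> * M \<le> n / 2"
    and m: "2 * ((1 - \<theta>) ^ m * M) + real (m * m * (2 * J + 3)) \<le> h" "m \<le> h"
    and XY_big: "11 * n \<le> 10 * card (X \<union> Y)" and n: "even n" "2 * J + 4 < n"
  shows "has_cycle V n"
proof -
  have XY: "X \<subseteq> V" "Y \<subseteq> V" "X = Y \<or> X \<inter> Y = {}"
    and dX: "\<And>x. x \<in> X \<Longrightarrow> d \<le> card (nb x Y)" and dY: "\<And>y. y \<in> Y \<Longrightarrow> d \<le> card (nb y X)"
    using rob by (auto simp: robust_def biregion_def)
  have finXY: "finite X" "finite Y"
    using finite_subset[OF XY(1) fin] finite_subset[OF XY(2) fin] by simp_all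
  have cardXY: "card X \<le> M" "card Y \<le> M"
    using V card_mono[OF fin XY(1)] card_mono[OF fin XY(2)] by linarith+
  have "0 < n"
    using n by simp
  have dh: "n / 2 < d - h" "0 < d - h" "h < d" "0 < d"
    using const \<open>0 < n\<close> by linarith+
  \<comment> \<open>Used twice: the second time with \<open>S = R1\<close>, which makes
    \<open>R2\<close> disjoint from \<open>R1\<close> and so the ends of every link
    distinct.\<close>
  have dom: "\<exists>R\<subseteq>Y - S. card R \<le> m \<and> card {x \<in> X. nb x R = {}} \<le> (1 - \<theta>) ^ m * M"
    if S: "finite S" "card S \<le> m" for S
  proof -
    have big: "n / 2 \<le> card (nb x (Y - S))" if x: "x \<in> X" for x
    proof -
      have "card (nb x Y) \<le> card (nb x (Y - S)) + card (nb x {}) + card (nb x {}) + card S"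
        using finXY S by (intro card_nb_cover) auto
      then show ?thesis
        using dX[OF x] S(2) m(2) dh by (simp add: nb_def)
    qed
    obtain x where "x \<in> X"
      using rob unfolding robust_def biregion_def by blast
    then have "card (nb x (Y - S)) \<noteq> 0"
      using big[of x] \<open>0 < n\<close> by linarith
    then have "Y - S \<noteq> {}"
      using nb_subset by (metis card.empty subset_empty)
    have "card (Y - S) \<le> M"
      using cardXY card_mono[OF finXY(2), of "Y - S"] by fastforce
    then have "\<theta> * card (Y - S) \<le> n / 2"
      using \<theta> mult_left_mono[of "card (Y - S)" M \<theta>] by linarith
    then have "\<theta> * card (Y - S) \<le> card (nb x (Y - S))" if "x \<in> X" for x
      using big[OF that] by linarith
    then obtain R where R: "R \<subseteq> Y - S" "card R \<le> m" "card {x \<in> X. nb x R = {}} \<le> (1 - \<theta>) ^ m * card X"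
      using dominating_subset[OF finXY(1) _ \<open>Y - S \<noteq> {}\<close> \<theta>(2), of m] finXY by auto
    have "(1 - \<theta>) ^ m * card X \<le> (1 - \<theta>) ^ m * M"
      using cardXY \<theta> by (intro mult_left_mono) auto
    then show ?thesis
      using R by (meson order_trans)
  qed
  obtain R1 where R1: "R1 \<subseteq> Y" "card R1 \<le> m" "card {x \<in> X. nb x R1 = {}} \<le> (1 - \<theta>) ^ m * M"
    using dom[of "{}"] by auto
  have finR1: "finite R1"
    using R1 finXY finite_subset by blast
  obtain R2 where R2: "R2 \<subseteq> Y - R1" "card R2 \<le> m" "card {x \<in> X. nb x R2 = {}} \<le> (1 - \<theta>) ^ m * M"
    using dom[OF finR1 R1(2)] by auto
  have finR2: "finite R2"
    using R2 finXY finite_subset by blast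
  \<comment> \<open>Both ends lie in \<open>Y\<close>, hence the swapped pair.\<close>
  have "\<exists>xs. is_path xs \<and> length xs = 2 * J + 3 \<and> hd xs = s \<and> last xs = r \<and> set xs \<subseteq> V"
    if "r \<in> R1" "s \<in> R2" for r s
    using that R1(1) R2(1) \<open>0 < n\<close>
    by (intro robust_link[OF fin V robust_swap[OF rob dh(4,3)] const _ J]) auto
  then obtain lk where lk: "\<And>r s. r \<in> R1 \<Longrightarrow> s \<in> R2 \<Longrightarrow> is_path (lk r s) \<and> length (lk r s) = 2 * J + 3 \<and>
      hd (lk r s) = s \<and> last (lk r s) = r \<and> set (lk r s) \<subseteq> V"
    by metis
  define T where "T = (\<Union>(r, s)\<in>R1 \<times> R2. set (lk r s))"
  have finT: "finite T"
    using finR1 finR2 by (auto simp: T_def)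
  have "card T \<le> m * m * (2 * J + 3)"
  proof -
    have "card T \<le> (\<Sum>(r, s)\<in>R1 \<times> R2. card (set (lk r s)))"
      unfolding T_def using finR1 finR2 card_UN_le[of "R1 \<times> R2" "\<lambda>(r, s). set (lk r s)"] by (simp add: case_prod_unfold)
    also have "\<dots> \<le> (\<Sum>(r, s)\<in>R1 \<times> R2. 2 * J + 3)"
    proof (rule sum_mono, clarify)
      fix r s assume "r \<in> R1" "s \<in> R2"
      then show "card (set (lk r s)) \<le> 2 * J + 3"
        using lk card_length[of "lk r s"] by metis
    qed
    also have "\<dots> = card R1 * card R2 * (2 * J + 3)"
      by (simp add: card_cartesian_product)
    also have "\<dots> \<le> m * m * (2 * J + 3)"
      using R1(2) R2(2) by (intro mult_le_mono) auto
    finally show ?thesis .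
  qed
  \<comment> \<open>Any vertex of \<open>X\<close> outside \<open>Ex\<close> has a neighbour in
    \<open>R1\<close> and one in \<open>R2\<close>, so whatever ends the segment has in
    \<open>X\<close>, a link fits.\<close>
  define Ex where "Ex = {x \<in> X. nb x R1 = {}} \<union> {x \<in> X. nb x R2 = {}}"
  define D where "D = T \<union> Ex"
  have D: "finite D"
    using finT finXY by (simp add: D_def Ex_def)
  have "card D \<le> card T + (card {x \<in> X. nb x R1 = {}} + card {x \<in> X. nb x R2 = {}})"
    unfolding D_def Ex_def
    using card_Un_le[of T "{x \<in> X. nb x R1 = {}} \<union> {x \<in> X. nb x R2 = {}}"]
      card_Un_le[of "{x \<in> X. nb x R1 = {}}" "{x \<in> X. nb x R2 = {}}"] by linarith
  then have "real (card D) \<le> real (m * m * (2 * J + 3)) + 2 * ((1 - \<theta>) ^ m * M)"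
    using \<open>card T \<le> m * m * (2 * J + 3)\<close> R1(3) R2(3) by linarith
  then have cD: "card D \<le> h"
    using m(1) by linarith
  \<comment> \<open>A segment of \<open>l - 1\<close> vertices and a link of
    \<open>2 * J + 3\<close> add up to \<open>n\<close>. The spare vertex leaves a choice of which
    end to drop.\<close>
  define l where "l = n - 2 * J - 2"
  have l: "0 < l" "l \<le> real n" "l + card D \<le> card (X \<union> Y)" "even l" "2 < l"
    using n cD const XY_big by (auto simp: l_def)
  obtain ps where ps: "is_path ps" "length ps = l" "set ps \<subseteq> (X \<union> Y) - D"
    "successively (\<lambda>u v. u \<in> X \<and> v \<in> Y \<or> u \<in> Y \<and> v \<in> X) ps"
    using robust_long_path[OF fin rob D cD dh(1,2) l(1-3)] by blast
  \<comment> \<open>If the path starts in \<open>X\<close>, drop its last vertex; otherwise its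
    second vertex lies in \<open>X\<close>, and the first is dropped.\<close>
  have "\<exists>qs. is_path qs \<and> length qs = l - 1 \<and> set qs \<subseteq> (X \<union> Y) - D \<and> hd qs \<in> X \<and>
    successively (\<lambda>u v. u \<in> X \<and> v \<in> Y \<or> u \<in> Y \<and> v \<in> X) qs"
  proof -
    obtain p p' ps' where eq: "ps = p # p' # ps'" "ps' \<noteq> []"
      using ps(2) l(5) by (cases ps; cases "tl ps"; cases "tl (tl ps)") auto
    show ?thesis
    proof (cases "p \<in> X")
      case True
      have snoc: "ps = butlast ps @ [last ps]"
        using eq by simp
      have "is_path (butlast ps)"
        using ps(1) is_path_append[of "butlast ps" "[last ps]"] snoc by simp
      moreover have "successively (\<lambda>u v. u \<in> X \<and> v \<in> Y \<or> u \<in> Y \<and> v \<in> X) (butlast ps)"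
        using ps(4) successively_append_iff[of _ "butlast ps" "[last ps]"] snoc by simp
      ultimately show ?thesis
        using True ps(2,3) eq by (intro exI[of _ "butlast ps"]) (auto dest: in_set_butlastD)
    next
      case False
      then have "p' \<in> X"
        using ps(4) eq by auto
      then show ?thesis
        using ps eq by (intro exI[of _ "tl ps"]) (auto simp: is_path_Cons)
    qed
  qed
  then obtain qs where qs: "is_path qs" "length qs = l - 1" "set qs \<subseteq> (X \<union> Y) - D" "hd qs \<in> X"
    "successively (\<lambda>u v. u \<in> X \<and> v \<in> Y \<or> u \<in> Y \<and> v \<in> X) qs"
    by blast
  have "qs \<noteq> []"
    using qs(2) l(5) by auto
  \<comment> \<open>As \<open>n\<close> is even, \<open>l - 1\<close> is odd, so the segment ends on
    the side where it starts.\<close>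
  have "last qs \<in> X"
    using XY(3)
  proof
    assume "X \<inter> Y = {}"
    then show ?thesis
      using alternating_last[OF qs(5) _ _ qs(4)] qs(2) l by simp
  next
    assume "X = Y"
    then show ?thesis
      using qs(3) last_in_set[OF \<open>qs \<noteq> []\<close>] by blast
  qed
  have "hd qs \<notin> D" "last qs \<notin> D"
    using qs(3) hd_in_set[OF \<open>qs \<noteq> []\<close>] last_in_set[OF \<open>qs \<noteq> []\<close>] by blast+
  then have "nb (hd qs) R1 \<noteq> {}" "nb (last qs) R2 \<noteq> {}"
    using qs(4) \<open>last qs \<in> X\<close> by (auto simp: D_def Ex_def)
  then obtain r s where rs: "r \<in> R1" "E (hd qs) r" "s \<in> R2" "E (last qs) s"
    by (auto simp: nb_def)
  have "set (lk r s) \<subseteq> T"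
    using rs by (auto simp: T_def)
  then have "set qs \<inter> set (lk r s) = {}"
    using qs(3) by (auto simp: D_def)
  moreover have "lk r s \<noteq> []"
    using lk[OF rs(1,3)] by auto
  ultimately have "is_path (qs @ lk r s)"
    using qs(1) lk[OF rs(1,3)] rs(4) by (simp add: is_path_append)
  moreover have "length (qs @ lk r s) = n"
    using qs(2) lk[OF rs(1,3)] n by (simp add: l_def)
  moreover have "set (qs @ lk r s) \<subseteq> V"
    using qs(3) lk[OF rs(1,3)] XY by auto
  ultimately show ?thesis
    unfolding has_cycle_def using lk[OF rs(1,3)] sym[OF rs(2)] \<open>qs \<noteq> []\<close> \<open>lk r s \<noteq> []\<close>
    by (intro exI[of _ "qs @ lk r s"]) auto
qed

section \<open>Both sizes of a robust pair combined\<close>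

text \<open>With degrees at least \<open>19 * n / 20\<close> among fewer than
  \<open>11 * n / 10\<close> vertices, each vertex misses less than \<open>3 * n / 20\<close> of
  \<open>X \<union> Y\<close>. From \<open>n\<close> vertices on this is dense enough for a cycle
  inside; below \<open>n\<close> at most \<open>n / 20\<close> are missed, and excursions help
  out.\<close>

lemma cycle_if_robust_small:
  fixes d h :: real
  assumes fin: "finite V" and V: "card V \<le> K * n"
    and deg: "\<And>v. v \<in> V \<Longrightarrow> n - 1 \<le> card (nb v V)"
    and rob: "robust V n d h X Y" and d: "19 * n \<le> 20 * d" and n: "100 * K + 100 \<le> n"
    and small: "10 * card (X \<union> Y) < 11 * n"
  shows "has_cycle V n"
proof -
  define A where "A = X \<union> Y"
  have XY: "X \<subseteq> V" "Y \<subseteq> V" "X \<noteq> {}"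
    and dX: "\<And>x. x \<in> X \<Longrightarrow> d \<le> card (nb x Y)" and dY: "\<And>y. y \<in> Y \<Longrightarrow> d \<le> card (nb y X)"
    using rob by (auto simp: robust_def biregion_def)
  have "A \<subseteq> V"
    using XY by (simp add: A_def)
  have finA: "finite A"
    using finite_subset[OF \<open>A \<subseteq> V\<close> fin] .
  have dA: "d \<le> card (nb v A)" if v: "v \<in> A" for v
  proof (cases "v \<in> X")
    case True
    then show ?thesis
      using dX[OF True] card_nb_mono[of Y A v] finA by (simp add: A_def)
  next
    case False
    then have "v \<in> Y"
      using v by (simp add: A_def)
    then show ?thesis
      using dY[of v] card_nb_mono[of X A v] finA by (simp add: A_def)
  qed
  define x where "x = card A - nat \<lceil>d\<rceil>"
  have x: "card {u \<in> A. \<not> E v u} \<le> x" if v: "v \<in> A" for v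
  proof -
    have "{u \<in> A. \<not> E v u} = A - nb v A"
      by (auto simp: nb_def)
    then have "card {u \<in> A. \<not> E v u} = card A - card (nb v A)"
      using finA by (simp add: card_Diff_subset nb_subset)
    moreover have "nat \<lceil>d\<rceil> \<le> card (nb v A)"
      using dA[OF v] by linarith
    ultimately show ?thesis
      unfolding x_def by linarith
  qed
  obtain a where "a \<in> A"
    using XY by (auto simp: A_def)
  then have "nat \<lceil>d\<rceil> \<le> card A"
    using dA[of a] card_mono[OF finA nb_subset, of a] by linarith
  then have "x + nat \<lceil>d\<rceil> = card A"
    unfolding x_def by linarith
  moreover have "19 * n \<le> 20 * nat \<lceil>d\<rceil>"
    using d by linarith
  ultimately have c: "19 * n \<le> 20 * card A" "20 * x + 19 * n \<le> 20 * card A"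
    by linarith+
  show ?thesis
  proof (cases "card A < n")
    case True
    show ?thesis
      by (rule cycle_if_near_clique[OF fin \<open>A \<subseteq> V\<close> V deg x True])
        (use c True n in \<open>simp_all add: diff_mult_distrib2\<close>)
  next
    case False
    show ?thesis
      by (rule cycle_if_dense[OF finA \<open>A \<subseteq> V\<close> x]) (use c False n small in \<open>simp_all add: A_def\<close>)
  qed
qed

end

text \<open>It remains to fix the parameters: \<open>M = K * n\<close>,
  \<open>h = \<sigma> * n\<close>, \<open>b = \<beta> * n\<close>, \<open>t = g = h / 8\<close> and
  \<open>k = h / 12\<close>, whereas \<open>J\<close>, \<open>m\<close> and \<open>\<theta>\<close>
  do not depend on \<open>n\<close>.\<close>

lemma even_cycle_if_min_degree:
  fixes K :: nat
  assumes "K \<ge> 1"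
  shows "\<exists>n0. \<forall>n\<ge>n0. even n \<longrightarrow> (\<forall>(E :: 'a \<Rightarrow> 'a \<Rightarrow> bool) V. graph_rel E \<longrightarrow> finite V \<longrightarrow> V \<noteq> {} \<longrightarrow>
    card V \<le> K * n \<longrightarrow> (\<forall>v\<in>V. n - 1 \<le> card (graph_rel.nb E v V)) \<longrightarrow> graph_rel.has_cycle E V n)"
proof -
  \<comment> \<open>Up to \<open>4 * K + 2\<close> losses of \<open>h\<close> may cost no more than
    \<open>n / 20\<close>.\<close>
  define \<sigma> where "\<sigma> = 1 / (20 * (4 * real K + 3))"
  \<comment> \<open>Solves \<open>M * b = t * k\<close>.\<close>
  define \<beta> where "\<beta> = \<sigma>\<^sup>2 / (96 * K)"
  \<comment> \<open>The fraction that \<open>n / 2\<close> neighbours make up among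
    \<open>K * n\<close> vertices.\<close>
  define \<theta> where "\<theta> = 1 / (2 * real K)"
  have K: "real K \<ge> 1"
    using assms by simp
  have \<sigma>: "0 < \<sigma>" "\<sigma> \<le> 1 / 20" "(4 * real K + 2) * \<sigma> \<le> 1 / 20"
    using K by (simp_all add: \<sigma>_def field_simps)
  have \<theta>: "0 < \<theta>" "\<theta> \<le> 1" "\<theta> * K = 1 / 2"
    using K by (simp_all add: \<theta>_def field_simps)
  have \<beta>: "0 < \<beta>"
    using K \<sigma> by (simp add: \<beta>_def)
  have K\<beta>: "K * \<beta> = \<sigma> / 8 * (\<sigma> / 12)"
    using K by (simp add: \<beta>_def power2_eq_square)
  have "1 * \<beta> \<le> K * \<beta>"
    using K \<beta> by (intro mult_right_mono) auto
  also have "\<dots> \<le> \<sigma> / 8 * 1"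
    unfolding K\<beta> using \<sigma> by (intro mult_left_mono) auto
  finally have \<beta>\<sigma>: "\<beta> \<le> \<sigma> / 8"
    by simp
  \<comment> \<open>So many expansion steps, each gaining \<open>h / 8\<close>, exceed or reach
    \<open>K * n\<close>.\<close>
  define J where "J = nat \<lceil>8 * K / \<sigma>\<rceil>"
  have "8 * K / \<sigma> \<le> real J"
    unfolding J_def by linarith
  then have J: "K \<le> real J * (\<sigma> / 8)"
    using \<sigma> by (simp add: field_simps)
  \<comment> \<open>Each of the two dominating sets then misses at most \<open>h / 4\<close>
    vertices.\<close>
  obtain m where m: "(1 - \<theta>) ^ m < \<sigma> / (4 * K)"
    using real_arch_pow_inv[of "\<sigma> / (4 * K)" "1 - \<theta>"] \<sigma> \<theta> K by auto
  \<comment> \<open>The three thresholds ensure \<open>b > 2 * J + 2\<close>, at most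
    \<open>h / 2\<close> vertices on all links together, and \<open>h > m + 1\<close>.\<close>
  obtain n1 where n1: "(2 * real J + 2) / \<beta> < real n1"
    using reals_Archimedean2 by blast
  obtain n2 where n2: "2 * real (m * m * (2 * J + 3)) / \<sigma> < real n2"
    using reals_Archimedean2 by blast
  obtain n3 where n3: "(m + 1) / \<sigma> < real n3"
    using reals_Archimedean2 by blast
  have "graph_rel.has_cycle E V n"
    if n: "n1 + n2 + n3 + (2 * J + 5) + (100 * K + 100) \<le> n" "even n" and "graph_rel E"
      and V: "finite V" "V \<noteq> {}" "card V \<le> K * n" and deg: "\<forall>v\<in>V. n - 1 \<le> card (graph_rel.nb E v V)"
    for n V and E :: "'a \<Rightarrow> 'a \<Rightarrow> bool"
  proof -
    interpret graph_rel E by fact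
    define h where "h = \<sigma> * n"
    have rn: "0 < real n"
      using n(1) by simp
    have nb1: "2 * real J + 2 < \<beta> * n"
    proof -
      have "(2 * real J + 2) / \<beta> < n"
        using n1 n(1) by linarith
      then show ?thesis
        using \<beta> by (simp add: field_simps)
    qed
    have nb2: "2 * real (m * m * (2 * J + 3)) < h"
    proof -
      have "2 * real (m * m * (2 * J + 3)) / \<sigma> < n"
        using n2 n(1) by linarith
      then show ?thesis
        using \<sigma> by (simp add: field_simps h_def)
    qed
    have nb3: "m + 1 < h"
    proof -
      have "(m + 1) / \<sigma> < n"
        using n3 n(1) by linarith
      then show ?thesis
        using \<sigma> by (simp add: field_simps h_def)
    qed
    \<comment> \<open>Since \<open>h > 1\<close>, the pair \<open>(V, V)\<close> can start the
      search for a robust pair.\<close>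
    have "real n - h \<le> card (nb v V)" if "v \<in> V" for v
      using deg that nb3 by fastforce
    then have "biregion V (n - h) V V"
      using V by (simp add: biregion_def)
    then obtain i X Y where i: "i \<le> 4 * K + 1" and rob: "robust V n (n - real (i + 1) * h) h X Y"
      using exists_robust[of V n h K] V rn by auto
    define d where "d = n - real (i + 1) * h"
    have "real (i + 1) * h \<le> (4 * real K + 2) * h"
      using i nb3 by (intro mult_right_mono) auto
    also have "\<dots> = ((4 * real K + 2) * \<sigma>) * n"
      by (simp add: h_def)
    also have "\<dots> \<le> 1 / 20 * n"
      using \<sigma>(3) rn by (intro mult_right_mono) auto
    finally have d: "19 * real n \<le> 20 * d"
      by (simp add: d_def)
    show ?thesis
    proof (cases "10 * card (X \<union> Y) < 11 * n")
      case True
      show ?thesis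
        using cycle_if_robust_small[OF V(1,3) _ rob[folded d_def] d _ True] deg n(1) by auto
    next
      case False
      have "h \<le> n / 20"
        using mult_right_mono[OF \<sigma>(2), of n] by (simp add: h_def)
      have "(K * real n) * (\<beta> * n) = (K * \<beta>) * (n * real n)"
        by simp
      also have "\<dots> = (h / 8) * (h / 12)"
        unfolding K\<beta> by (simp add: h_def)
      finally have const: "(K * real n) * (\<beta> * n) \<le> (h / 8) * (h / 12)"
        by simp
      have b: "\<beta> * n \<le> h / 8"
        using mult_right_mono[OF \<beta>\<sigma>, of n] by (simp add: h_def)
      have JM: "K * real n \<le> real J * (h / 8)"
        using mult_right_mono[OF J, of n] by (simp add: h_def)
      have "(1 - \<theta>) ^ m * (K * real n) \<le> \<sigma> / (4 * K) * (K * real n)"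
        using m by (intro mult_right_mono) auto
      also have "\<dots> = h / 4"
        using K by (simp add: h_def)
      finally have mM: "2 * ((1 - \<theta>) ^ m * (K * real n)) + real (m * m * (2 * J + 3)) \<le> h"
        using nb2 by linarith
      have "card V \<le> K * real n"
        using V(3) by (metis of_nat_mono of_nat_mult)
      moreover have "\<theta> * (K * real n) \<le> n / 2"
        unfolding mult.assoc[symmetric] \<theta>(3) by simp
      moreover have "0 < \<beta> * n"
        using \<beta> rn by simp
      moreover have "\<beta> * n \<le> d"
        using b d \<open>h \<le> n / 20\<close> rn by linarith
      ultimately show ?thesis
        using cycle_if_robust[OF V(1) _ rob[folded d_def] _ b const _ _ \<open>h \<le> n / 20\<close> _ _ JM nb1 _ \<theta>(2) _ mM _ _ n(2)]
          \<theta>(1) nb3 d n(1) False by simp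
    qed
  qed
  then show ?thesis
    by blast
qed

section \<open>The Ramsey number\<close>

text \<open>A vertex of degree below \<open>n - 1\<close> joins the spine of a book found among its
  non-neighbours; without such a vertex \<open>cyc\<close> applies. For \<open>j = 0\<close> the
  \<open>n\<close> vertices themselves are the pages.\<close>

lemma cycle_or_book:
  fixes E :: "'a \<Rightarrow> 'a \<Rightarrow> bool"
  assumes E: "graph_rel E" and "1 \<le> n"
    and cyc: "\<And>V. finite V \<Longrightarrow> V \<noteq> {} \<Longrightarrow> card V \<le> (k + 1) * n \<Longrightarrow>
      \<forall>v\<in>V. n - 1 \<le> card (graph_rel.nb E v V) \<Longrightarrow> graph_rel.has_cycle E V n"
    and "j \<le> k" "finite V" "card V = (j + 1) * (n - 1) + 1"
  shows "graph_rel.has_cycle E V n \<or>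
    (\<exists>S T. S \<subseteq> V \<and> T \<subseteq> V \<and> S \<inter> T = {} \<and> card S = j \<and> card T = n \<and>
      (\<forall>s\<in>S. \<forall>t\<in>S \<union> T. \<not> E s t))"
  using assms(4-6)
proof (induction j arbitrary: V)
  case 0
  then show ?case
    using \<open>1 \<le> n\<close> by (intro disjI2 exI[of _ "{}"] exI[of _ V]) auto
next
  case (Suc j)
  interpret graph_rel E by fact
  show ?case
  proof (cases "\<forall>v\<in>V. n - 1 \<le> card (nb v V)")
    case True
    have "card V \<le> (Suc j + 1) * n"
      using Suc.prems(3) \<open>1 \<le> n\<close> by (cases n) auto
    also have "\<dots> \<le> (k + 1) * n"
      using Suc.prems(1) by (intro mult_right_mono) auto
    finally have "has_cycle V n"
      using Suc.prems(2,3) True by (intro cyc) auto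
    then show ?thesis ..
  next
    case False
    then obtain v where v: "v \<in> V" "card (nb v V) < n - 1"
      by force
    let ?W = "V - insert v (nb v V)"
    have fin: "finite (nb v V)" "v \<notin> nb v V" "insert v (nb v V) \<subseteq> V"
      using Suc.prems(2) irrefl v by (auto simp: nb_def)
    \<comment> \<open>At most \<open>n - 1\<close> vertices are removed, \<open>v\<close> included,
      which is what one spine vertex may cost.\<close>
    have "card ?W = card V - Suc (card (nb v V))"
      using fin by (subst card_Diff_subset) auto
    then have "(j + 1) * (n - 1) + 1 \<le> card ?W"
      using Suc.prems(3) v(2) by simp
    then obtain U where U: "U \<subseteq> ?W" "card U = (j + 1) * (n - 1) + 1" "finite U"
      by (rule obtain_subset_with_card_n)
    have "has_cycle U n \<or> (\<exists>S T. S \<subseteq> U \<and> T \<subseteq> U \<and> S \<inter> T = {} \<and> card S = j \<and> card T = n \<and>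
        (\<forall>s\<in>S. \<forall>t\<in>S \<union> T. \<not> E s t))"
      using Suc.IH[OF _ U(3,2)] Suc.prems(1) by simp
    then consider "has_cycle U n" | S T where "S \<subseteq> U" "T \<subseteq> U" "S \<inter> T = {}" "card S = j" "card T = n"
        "\<forall>s\<in>S. \<forall>t\<in>S \<union> T. \<not> E s t"
      by blast
    then show ?thesis
    proof cases
      case 1
      then have "has_cycle V n"
        using U(1) unfolding has_cycle_def by blast
      then show ?thesis ..
    next
      case ST: 2
      have no: "\<not> E v u" "\<not> E u v" if "u \<in> U" for u
        using that U(1) sym unfolding nb_def by blast+
      have "v \<notin> U"
        using U(1) by blast
      then have "card (insert v S) = Suc j"
        using ST(1,4) U(3) by (metis card_insert_disjoint finite_subset subsetD)
      moreover have "\<forall>s\<in>insert v S. \<forall>t\<in>insert v S \<union> T. \<not> E s t"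
        using ST no irrefl by blast
      moreover have "insert v S \<inter> T = {}" "insert v S \<subseteq> V" "T \<subseteq> V"
        using ST \<open>v \<notin> U\<close> v(1) U(1) by auto
      ultimately show ?thesis
        using ST(5) by blast
    qed
  qed
qed

lemma graph_rel_edges:
  assumes "simple_graph \<Gamma>"
  shows "graph_rel (\<lambda>u v. {u, v} \<in> edges \<Gamma>)"
proof
  show "{x, x} \<notin> edges \<Gamma>" for x
    using assms by (auto simp: simple_graph_def nsets_def)
qed (simp add: insert_commute)

lemma contains_cycle:
  assumes \<Gamma>: "simple_graph \<Gamma>" and "graph_rel.has_cycle (\<lambda>u v. {u, v} \<in> edges \<Gamma>) (verts \<Gamma>) n"
  shows "contains_copy \<Gamma> (cycle_graph n)"
proof -
  interpret graph_rel "\<lambda>u v. {u, v} \<in> edges \<Gamma>"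
    using \<Gamma> by (rule graph_rel_edges)
  obtain xs where xs: "length xs = n" "set xs \<subseteq> verts \<Gamma>" "is_path xs" "xs \<noteq> []" "{last xs, hd xs} \<in> edges \<Gamma>"
    using assms(2) unfolding has_cycle_def by blast
  have dist: "distinct xs" and succ: "successively (\<lambda>u v. {u, v} \<in> edges \<Gamma>) xs"
    using xs(3) by (auto simp: is_path_def)
  have "{xs ! i, xs ! (Suc i mod n)} \<in> edges \<Gamma>" if "i < n" for i
  proof (cases "Suc i = n")
    case True
    then show ?thesis
      using xs(1,4,5) by (auto simp: hd_conv_nth last_conv_nth)
  next
    case False
    then show ?thesis
      using succ that xs(1) by (auto simp: successively_conv_nth)
  qed
  then show ?thesis
    unfolding contains_copy_def cycle_graph_def using dist xs(1,2)
    by (intro exI[of _ "(!) xs"]) (auto simp: inj_on_nth)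
qed

lemma contains_book:
  assumes \<Gamma>: "simple_graph \<Gamma>" and S: "S \<subseteq> verts \<Gamma>" "card S = k" and T: "T \<subseteq> verts \<Gamma>" "card T = n"
    and "S \<inter> T = {}" and no: "\<forall>s\<in>S. \<forall>t\<in>S \<union> T. {s, t} \<notin> edges \<Gamma>"
  shows "contains_copy (complement \<Gamma>) (book_graph k n)"
proof -
  have fin: "finite S" "finite T"
    using \<Gamma> S T finite_subset by (auto simp: simple_graph_def)
  obtain xs ys where xs: "set xs = S" "distinct xs" and ys: "set ys = T" "distinct ys"
    using finite_distinct_list fin by metis
  have len: "length xs = k" "length ys = n"
    using xs ys S T by (metis distinct_card)+
  let ?zs = "xs @ ys"
  have dist: "distinct ?zs"
    using xs ys \<open>S \<inter> T = {}\<close> by simp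
  have "{?zs ! i, ?zs ! j} \<in> edges (complement \<Gamma>)" if "i < k" "j < k + n" "i \<noteq> j" for i j
  proof -
    have "?zs ! i \<in> S"
      using that len xs by (metis nth_append nth_mem)
    moreover have "?zs ! j \<in> S \<union> T"
      using that len xs(1) ys(1) by (metis length_append nth_mem set_append)
    moreover have "?zs ! i \<noteq> ?zs ! j"
      using that len dist by (simp add: nth_eq_iff_index_eq)
    ultimately show ?thesis
      using no S T by (auto simp: complement_def nsets_def)
  qed
  moreover have "(!) zs ` {..<length zs} = set zs" for zs :: "'a list"
    by (auto simp: set_conv_nth)
  then have "(!) ?zs ` {..<k + n} = S \<union> T"
    using len xs(1) ys(1) by (metis length_append set_append)
  moreover have "inj_on ((!) ?zs) {..<k + n}"
    using dist len by (intro inj_on_nth) auto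
  moreover have "S \<union> T \<subseteq> verts (complement \<Gamma>)"
    using S T by (simp add: complement_def)
  ultimately show ?thesis
    unfolding contains_copy_def book_graph_def by (intro exI[of _ "(!) ?zs"]) auto
qed

section \<open>Lower bound by disjoint cliques\<close>

text \<open>Disjoint cliques on blocks of \<open>m\<close> consecutive numbers, the last one
  possibly truncated. \<open>N\<close> is arbitrary because minimality calls for a bad graph on
  every smaller number of vertices.\<close>

definition clique_union :: "nat \<Rightarrow> nat \<Rightarrow> nat ugraph" where
  "clique_union m N = \<lparr>verts = {..<N}, edges = {{i, j} | i j. i < N \<and> j < N \<and> i \<noteq> j \<and> i div m = j div m}\<rparr>"

lemma simple_graph_clique_union: "simple_graph (clique_union m N)"
  by (auto simp: simple_graph_def clique_union_def nsets_def)

lemma edge_clique_union: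
  "{i, j} \<in> edges (clique_union m N) \<longleftrightarrow> i < N \<and> j < N \<and> i \<noteq> j \<and> i div m = j div m"
  by (auto simp: clique_union_def doubleton_eq_iff)

lemma card_div_class_le:
  fixes A :: "nat set"
  assumes "m > 0" "\<And>a. a \<in> A \<Longrightarrow> a div m = c"
  shows "card A \<le> m"
proof -
  have "A \<subseteq> {c * m..<c * m + m}"
  proof
    fix a assume "a \<in> A"
    then have "a = c * m + a mod m"
      using assms(2) div_mult_mod_eq[of a m] by simp
    moreover have "a mod m < m"
      using assms(1) by simp
    ultimately show "a \<in> {c * m..<c * m + m}"
      by (metis atLeastLessThan_iff le_add1 nat_add_left_cancel_less)
  qed
  then show ?thesis
    using card_mono[of "{c * m..<c * m + m}" A] by simp
qed

text \<open>A cycle is connected, so its \<open>n\<close> vertices would share a block of size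
  \<open>n - 1\<close>.\<close>

lemma clique_union_no_cycle:
  assumes "n \<ge> 2"
  shows "\<not> contains_copy (clique_union (n - 1) N) (cycle_graph n)"
proof
  assume "contains_copy (clique_union (n - 1) N) (cycle_graph n)"
  then obtain f where f: "inj_on f {..<n}"
    "\<And>e. e \<in> edges (cycle_graph n) \<Longrightarrow> f ` e \<in> edges (clique_union (n - 1) N)"
    by (auto simp: contains_copy_def cycle_graph_def)
  have step: "f i div (n - 1) = f (Suc i) div (n - 1)" if "Suc i < n" for i
  proof -
    have "{i, Suc i} \<in> edges (cycle_graph n)"
      using that by (auto simp: cycle_graph_def intro!: exI[of _ i])
    then have "{f i, f (Suc i)} \<in> edges (clique_union (n - 1) N)"
      using f(2) by fastforce
    then show ?thesis
      by (simp add: edge_clique_union)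
  qed
  have const: "f i div (n - 1) = f 0 div (n - 1)" if "i < n" for i
    using that by (induction i) (use step in auto)
  have "card (f ` {..<n}) \<le> n - 1"
  proof (rule card_div_class_le)
    show "a div (n - 1) = f 0 div (n - 1)" if "a \<in> f ` {..<n}" for a
      using that const by blast
  qed (use assms in simp)
  then show False
    using f(1) assms by (simp add: card_image)
qed

text \<open>The spine of a book would occupy \<open>k\<close> different cliques, leaving a single clique for all pages.\<close>

lemma clique_union_no_book:
  assumes "n \<ge> 2" "N \<le> (k + 1) * (n - 1)"
  shows "\<not> contains_copy (complement (clique_union (n - 1) N)) (book_graph k n)"
proof
  let ?G = "clique_union (n - 1) N"
  assume "contains_copy (complement ?G) (book_graph k n)"
  then obtain f where f: "inj_on f {..<k + n}" "f ` {..<k + n} \<subseteq> {..<N}"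
    "\<And>e. e \<in> edges (book_graph k n) \<Longrightarrow> f ` e \<in> edges (complement ?G)"
    by (auto simp: contains_copy_def book_graph_def complement_def clique_union_def)
  define c where "c i = f i div (n - 1)" for i
  \<comment> \<open>In the book a spine vertex is adjacent to all others, so in the complement of
    the cliques it shares its block with none of them.\<close>
  have neq: "c i \<noteq> c j" if "i < k" "j < k + n" "i \<noteq> j" for i j
  proof -
    have "{i, j} \<in> edges (book_graph k n)"
      using that by (auto simp: book_graph_def)
    then have "{f i, f j} \<in> edges (complement ?G)"
      using f(3) by fastforce
    then have "{f i, f j} \<notin> edges ?G"
      by (simp add: complement_def)
    moreover have "f i < N" "f j < N"
      using f(2) that by (simp_all add: image_subset_iff)
    moreover have "f i \<noteq> f j"
      using inj_onD[OF f(1), of i j] that by auto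
    ultimately show ?thesis
      by (simp add: edge_clique_union c_def)
  qed
  have c_lt: "c i < k + 1" if "i < k + n" for i
  proof -
    have "f i < N"
      using f(2) that by (simp add: image_subset_iff)
    then have "f i < (k + 1) * (n - 1)"
      using assms(2) by (rule less_le_trans)
    then show ?thesis
      unfolding c_def using assms(1) by (simp add: less_mult_imp_div_less)
  qed
  have "inj_on c {..<k}"
    unfolding inj_on_def using neq trans_less_add1 by blast
  then have "card (c ` {..<k}) = k"
    by (simp add: card_image)
  moreover have sub: "c ` {..<k} \<subseteq> {..<k + 1}"
    using c_lt by (auto simp del: add_Suc_right)
  ultimately have "card ({..<k + 1} - c ` {..<k}) = 1"
    by (simp add: card_Diff_subset)
  then obtain q where q: "{..<k + 1} - c ` {..<k} = {q}"
    by (meson card_1_singletonE)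
  have "c j = q" if "j \<in> {k..<k + n}" for j
  proof -
    have "c j \<in> {..<k + 1} - c ` {..<k}"
    proof -
      have "c j \<noteq> c i" if "i < k" for i
        using neq[of i j] that \<open>j \<in> {k..<k + n}\<close> by auto
      then show ?thesis
        using c_lt[of j] \<open>j \<in> {k..<k + n}\<close> by auto
    qed
    then show ?thesis
      using q by blast
  qed
  then have "card (f ` {k..<k + n}) \<le> n - 1"
    using assms by (intro card_div_class_le[of _ _ q]) (auto simp: c_def)
  moreover have "inj_on f {k..<k + n}"
    using f(1) by (rule inj_on_subset) auto
  ultimately show False
    using assms by (simp add: card_image)
qed

theorem corollary1p1:
  fixes k :: nat
  assumes "k \<ge> 1"
  shows "\<exists>n\<^sub>0 > 0. \<forall>n \<ge> n\<^sub>0. even n \<longrightarrow>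
    ramsey_number (cycle_graph n) (book_graph k n) = (k + 1) * (n - 1) + 1"
proof -
  obtain n0 where n0: "\<And>n (E :: nat \<Rightarrow> nat \<Rightarrow> bool) V. n0 \<le> n \<Longrightarrow> even n \<Longrightarrow> graph_rel E \<Longrightarrow> finite V \<Longrightarrow> V \<noteq> {} \<Longrightarrow>
      card V \<le> (k + 1) * n \<Longrightarrow> \<forall>v\<in>V. n - 1 \<le> card (graph_rel.nb E v V) \<Longrightarrow> graph_rel.has_cycle E V n"
    using even_cycle_if_min_degree[of "k + 1", where ?'a = nat] by (metis le_add2)
  \<comment> \<open>The summand \<open>2\<close> secures \<open>n \<ge> 2\<close>, so that the
    blocks of the lower bound are nonempty.\<close>
  have "ramsey_number (cycle_graph n) (book_graph k n) = (k + 1) * (n - 1) + 1"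
    if n: "n \<ge> n0 + 2" "even n" for n
    unfolding ramsey_number_def
  proof (rule Least_equality, intro allI impI)
    fix \<Gamma> :: "nat ugraph"
    assume \<Gamma>: "simple_graph \<Gamma> \<and> card (verts \<Gamma>) = (k + 1) * (n - 1) + 1"
    let ?E = "\<lambda>u v. {u, v} \<in> edges \<Gamma>"
    have E: "graph_rel ?E"
      using \<Gamma> graph_rel_edges by blast
    have "graph_rel.has_cycle ?E (verts \<Gamma>) n \<or>
      (\<exists>S T. S \<subseteq> verts \<Gamma> \<and> T \<subseteq> verts \<Gamma> \<and> S \<inter> T = {} \<and> card S = k \<and> card T = n \<and>
        (\<forall>s\<in>S. \<forall>t\<in>S \<union> T. \<not> ?E s t))"
      using n \<Gamma> by (intro cycle_or_book[OF E, where k = k] n0 E) (auto simp: simple_graph_def)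
    then show "contains_copy \<Gamma> (cycle_graph n) \<or> contains_copy (complement \<Gamma>) (book_graph k n)"
    proof (rule disj_forward)
      show "contains_copy (complement \<Gamma>) (book_graph k n)"
        if "\<exists>S T. S \<subseteq> verts \<Gamma> \<and> T \<subseteq> verts \<Gamma> \<and> S \<inter> T = {} \<and> card S = k \<and> card T = n \<and>
          (\<forall>s\<in>S. \<forall>t\<in>S \<union> T. \<not> ?E s t)"
        using that \<Gamma> by (elim exE conjE) (rule contains_book; simp)
      show "contains_copy \<Gamma> (cycle_graph n)" if "graph_rel.has_cycle ?E (verts \<Gamma>) n"
        using contains_cycle[OF _ that] \<Gamma> by simp
    qed
  next
    fix N
    assume N: "\<forall>\<Gamma> :: nat ugraph. simple_graph \<Gamma> \<and> card (verts \<Gamma>) = N \<longrightarrow>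
      contains_copy \<Gamma> (cycle_graph n) \<or> contains_copy (complement \<Gamma>) (book_graph k n)"
    show "(k + 1) * (n - 1) + 1 \<le> N"
    proof (rule ccontr)
      assume "\<not> ?thesis"
      then have "N \<le> (k + 1) * (n - 1)"
        by simp
      moreover have "card (verts (clique_union (n - 1) N)) = N"
        by (simp add: clique_union_def)
      ultimately show False
        using N simple_graph_clique_union clique_union_no_cycle[of n N] clique_union_no_book[of n N k] n(1)
        by auto
    qed
  qed
  then show ?thesis
    by (intro exI[of _ "n0 + 2"]) auto
qed

end
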